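(* Consider the asymmetric log-GARCH$(p,q)$ model with innovations $(\eta_t)$ and associated random matrices $\mathbf{C}=(\boldsymbol{C}_t)_{t\in\mathbb{Z}}$, as defined in the context. Assume that $E\log^+|\log\eta_0^2|<\infty$. A sufficient condition for the existence of a strictly stationary solution to the log-GARCH model is $\gamma(\mathbf{C})<0$. Moreover, when $\gamma(\mathbf{C})<0$ there exists only one stationary solution, and this solution is nonanticipative and ergodic.
   Context: **Model.** The asymmetric log-GARCH$(p,q)$ model is, for $t\in\mathbb{Z}$, $$\epsilon_t=\sigma_t\eta_t,\qquad \log\sigma_t^2=\omega+\sum_{i=1}^q\left(\alpha_{i+}1_{\{\epsilon_{t-i}>0\}}+\alpha_{i-}1_{\{\epsilon_{t-i}<0\}}\right)\log\epsilon_{t-i}^2+\sum_{j=1}^p\beta_j\log\sigma_{t-j}^2,$$ where $\sigma_t>0$, the coefficients $\omega,\alpha_{i+},\alpha_{i-},\beta_j$ are real (no sign constraints), and $(\eta_t)_{t\in\mathbb{Z}}$ is a given iid sequence of real random variables with $E\eta_0=0$, $E\eta_0^2=1$. Convention: $\log 0=-\infty$, so that finiteness of $E\log^+|\log\eta_0^2|$ entails $P(\eta_0=0)=0$. Write $\boldsymbol{\alpha}_+=(\alpha_{1+},\dots,\alpha_{q+})$, $\boldsymbol{\alpha}_-=(\alpha_{1-},\dots,\alpha_{q-})$, $\boldsymbol{\beta}=(\beta_1,\dots,\beta_p)$ (row vectors). **Matrices.** $\boldsymbol{I}_k$ is the $k\times k$ identity, $\mathbf{0}$ denotes zero vectors/matrices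 of the indicated size. $\boldsymbol{C}_t$ is the $(2q+p)\times(2q+p)$ matrix $$\boldsymbol{C}_t=\begin{pmatrix}1_{\{\eta_t>0\}}\boldsymbol{\alpha}_+&1_{\{\eta_t>0\}}\boldsymbol{\alpha}_-&1_{\{\eta_t>0\}}\boldsymbol{\beta}\\ (\boldsymbol{I}_{q-1}\ \mathbf{0}_{q-1})&\mathbf{0}_{(q-1)\times q}&\mathbf{0}_{(q-1)\times p}\\ 1_{\{\eta_t<0\}}\boldsymbol{\alpha}_+&1_{\{\eta_t<0\}}\boldsymbol{\alpha}_-&1_{\{\eta_t<0\}}\boldsymbol{\beta}\\ \mathbf{0}_{(q-1)\times q}&(\boldsymbol{I}_{q-1}\ \mathbf{0}_{q-1})&\mathbf{0}_{(q-1)\times p}\\ \boldsymbol{\alpha}_+&\boldsymbol{\alpha}_-&\boldsymbol{\beta}\\ \mathbf{0}_{(p-1)\times q}&\mathbf{0}_{(p-1)\times q}&(\boldsymbol{I}_{p-1}\ \mathbf{0}_{p-1})\end{pmatrix}$$ (with obvious changes, i.e. empty blocks dropped, when $p\le1$ or $q\le1$). **Top Lyapunov exponent.** $\gamma(\mathbf{C})=\lim_{t\to\infty}\frac1tE\log\|\boldsymbol{C}_t\boldsymbol{C}_{t-1}\cdots\boldsymbol{C}_1\|=\inf_{t\ge1}\frac1tE\log\|\boldsymbol{C}_t\cdots\boldsymbol{C}_1\|$ for any multiplicative (i.e. submultiplicative) matrix norm; the value does not depend on the norm, and $-\infty$ is allowed. **Solutions.** A strictly stationary solution is a strictly stationary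 process $(\epsilon_t,\sigma_t)_{t\in\mathbb{Z}}$, on the probability space carrying $(\eta_t)$, satisfying the model equations a.s. for all $t$; uniqueness is up to almost sure equality. Nonanticipative means that $\epsilon_t$ is a measurable function of $\{\eta_u:u\le t\}$. *)

theory Defs
  imports "HOL-Probability.Probability" "Jordan_Normal_Form.Matrix"
begin

text \<open>Logarithm with \<open>log 0 = -\<infinity>\<close>; the library's real \<^term>\<open>ln\<close> has \<open>ln 0 = 0\<close>.
  It is meant for nonnegative arguments.\<close>

definition elog :: "ereal \<Rightarrow> ereal" where
  "elog x = (if x \<le> 0 then -\<infinity> else if x = \<infinity> then \<infinity> else ereal (ln (real_of_ereal x)))"

definition elog_plus :: "ereal \<Rightarrow> ereal" where
  "elog_plus x = max 0 (elog x)"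

text \<open>Expectation of an extended real variable as \<open>E f\<^sup>+ - E f\<^sup>-\<close>. The coercion
  \<^term>\<open>e2ennreal\<close> truncates negative values to 0. The value is the usual one, possibly infinite,
  as soon as one of the two parts is finite.\<close>

definition ext_expectation :: "'a measure \<Rightarrow> ('a \<Rightarrow> ereal) \<Rightarrow> ereal" where
  "ext_expectation M f =
     enn2ereal (\<integral>\<^sup>+ x. e2ennreal (f x) \<partial>M) - enn2ereal (\<integral>\<^sup>+ x. e2ennreal (- f x) \<partial>M)"


section \<open>Stochastic processes indexed by the integers\<close>

definition identically_distributed ::
    "'a measure \<Rightarrow> 'b measure \<Rightarrow> (int \<Rightarrow> 'a \<Rightarrow> 'b) \<Rightarrow> bool" where
  "identically_distributed M N X \<longleftrightarrow> (\<forall>s t. distr M N (X s) = distr M N (X t))"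

definition iid :: "'a measure \<Rightarrow> 'b measure \<Rightarrow> (int \<Rightarrow> 'a \<Rightarrow> 'b) \<Rightarrow> bool" where
  "iid M N X \<longleftrightarrow> prob_space.indep_vars M (\<lambda>_. N) X UNIV \<and> identically_distributed M N X"

definition strictly_stationary ::
    "'a measure \<Rightarrow> 'b measure \<Rightarrow> (int \<Rightarrow> 'a \<Rightarrow> 'b) \<Rightarrow> bool" where
  "strictly_stationary M N X \<longleftrightarrow>
     (\<forall>t. X t \<in> M \<rightarrow>\<^sub>M N) \<and>
     (\<forall>J h. finite J \<longrightarrow>
        distr M (\<Pi>\<^sub>M t\<in>J. N) (\<lambda>x. \<lambda>t\<in>J. X (t + h) x) =
        distr M (\<Pi>\<^sub>M t\<in>J. N) (\<lambda>x. \<lambda>t\<in>J. X t x))"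

text \<open>Ergodicity of a stationary process: every shift-invariant event of the path space has
  probability 0 or 1.\<close>

definition ergodic_process ::
    "'a measure \<Rightarrow> 'b measure \<Rightarrow> (int \<Rightarrow> 'a \<Rightarrow> 'b) \<Rightarrow> bool" where
  "ergodic_process M N X \<longleftrightarrow>
     (\<forall>A \<in> sets (\<Pi>\<^sub>M t\<in>UNIV. N).
        (\<lambda>\<omega> t. \<omega> (t + 1)) -` A \<inter> space (\<Pi>\<^sub>M t\<in>(UNIV :: int set). N) = A \<longrightarrow>
        measure M {x \<in> space M. (\<lambda>t. X t x) \<in> A} \<in> {0, 1})"

definition nonanticipative ::
    "'a measure \<Rightarrow> (int \<Rightarrow> 'a \<Rightarrow> real) \<Rightarrow> (int \<Rightarrow> 'a \<Rightarrow> real) \<Rightarrow> bool" where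
  "nonanticipative M \<eta> \<epsilon> \<longleftrightarrow>
     (\<forall>t. \<exists>g \<in> borel_measurable (\<Pi>\<^sub>M u\<in>{..t}. borel).
        \<forall>x \<in> space M. \<epsilon> t x = g (\<lambda>u\<in>{..t}. \<eta> u x))"


section \<open>Top Lyapunov exponent\<close>

definition submultiplicative_norm :: "nat \<Rightarrow> (real mat \<Rightarrow> real) \<Rightarrow> bool" where
  "submultiplicative_norm n nrm \<longleftrightarrow>
     (\<forall>A \<in> carrier_mat n n. 0 \<le> nrm A \<and> (nrm A = 0 \<longleftrightarrow> A = 0\<^sub>m n n)) \<and>
     (\<forall>A \<in> carrier_mat n n. \<forall>c. nrm (c \<cdot>\<^sub>m A) = \<bar>c\<bar> * nrm A) \<and>
     (\<forall>A \<in> carrier_mat n n. \<forall>B \<in> carrier_mat n n. nrm (A + B) \<le> nrm A + nrm B) \<and>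
     (\<forall>A \<in> carrier_mat n n. \<forall>B \<in> carrier_mat n n. nrm (A * B) \<le> nrm A * nrm B)"

text \<open>\<open>back_prod n C t\<close> is \<open>C t * C (t - 1) * \<dots> * C 1\<close>.\<close>

primrec back_prod :: "nat \<Rightarrow> (int \<Rightarrow> real mat) \<Rightarrow> nat \<Rightarrow> real mat" where
  "back_prod n C 0 = 1\<^sub>m n"
| "back_prod n C (Suc t) = C (int (Suc t)) * back_prod n C t"

definition top_lyapunov ::
    "'a measure \<Rightarrow> nat \<Rightarrow> (real mat \<Rightarrow> real) \<Rightarrow> (int \<Rightarrow> 'a \<Rightarrow> real mat) \<Rightarrow> ereal" where
  "top_lyapunov M n nrm C =
     lim (\<lambda>t :: nat.
       ext_expectation M (\<lambda>x. elog (ereal (nrm (back_prod n (\<lambda>s. C s x) t)))) / ereal (real t))"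


section \<open>The asymmetric log-GARCH model\<close>

text \<open>The matrix \<open>C\<^sub>t\<close> as a function of the value \<open>e\<close> of \<open>\<eta>\<^sub>t\<close>. Indices start at 0, so the
  three row blocks (of heights \<open>q\<close>, \<open>q\<close>, \<open>p\<close>) start at rows \<open>0\<close>, \<open>q\<close> and \<open>2 * q\<close>; every other
  row belongs to one of the shift blocks \<open>(I 0)\<close> and has its only nonzero entry, a 1, just left of
  the diagonal. For \<open>q = 0\<close> or \<open>p = 0\<close> the corresponding blocks are empty. Coefficient
  sequences are indexed from 1.\<close>

definition coeff_row ::
    "nat \<Rightarrow> (nat \<Rightarrow> real) \<Rightarrow> (nat \<Rightarrow> real) \<Rightarrow> (nat \<Rightarrow> real) \<Rightarrow> nat \<Rightarrow> real" where
  "coeff_row q \<alpha>p \<alpha>m \<beta> j =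
     (if j < q then \<alpha>p (j + 1)
      else if j < 2 * q then \<alpha>m (j - q + 1)
      else \<beta> (j - 2 * q + 1))"

definition garch_matrix ::
    "nat \<Rightarrow> nat \<Rightarrow> (nat \<Rightarrow> real) \<Rightarrow> (nat \<Rightarrow> real) \<Rightarrow> (nat \<Rightarrow> real) \<Rightarrow> real \<Rightarrow> real mat" where
  "garch_matrix p q \<alpha>p \<alpha>m \<beta> e =
     mat (2 * q + p) (2 * q + p) (\<lambda>(i, j).
       if i < q \<and> i = 0 then of_bool (e > 0) * coeff_row q \<alpha>p \<alpha>m \<beta> j
       else if i < 2 * q \<and> i = q then of_bool (e < 0) * coeff_row q \<alpha>p \<alpha>m \<beta> j
       else if i = 2 * q then coeff_row q \<alpha>p \<alpha>m \<beta> j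
       else of_bool (i = j + 1))"

text \<open>In the model equation the real \<^term>\<open>ln\<close> agrees with the convention \<open>log 0 = -\<infinity>\<close>: both
  indicators vanish when \<open>\<epsilon> (t - i) x = 0\<close>, so the value of the logarithm is then irrelevant.\<close>

definition log_garch_equations ::
    "'a measure \<Rightarrow> (int \<Rightarrow> 'a \<Rightarrow> real) \<Rightarrow> nat \<Rightarrow> nat \<Rightarrow> real \<Rightarrow>
     (nat \<Rightarrow> real) \<Rightarrow> (nat \<Rightarrow> real) \<Rightarrow> (nat \<Rightarrow> real) \<Rightarrow>
     (int \<Rightarrow> 'a \<Rightarrow> real) \<Rightarrow> (int \<Rightarrow> 'a \<Rightarrow> real) \<Rightarrow> bool" where
  "log_garch_equations M \<eta> p q \<omega> \<alpha>p \<alpha>m \<beta> \<epsilon> \<sigma> \<longleftrightarrow>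
     (\<forall>t. AE x in M.
        \<sigma> t x > 0 \<and>
        \<epsilon> t x = \<sigma> t x * \<eta> t x \<and>
        ln ((\<sigma> t x)\<^sup>2) =
          \<omega> + (\<Sum>i = 1..q.
                 (\<alpha>p i * of_bool (\<epsilon> (t - int i) x > 0) + \<alpha>m i * of_bool (\<epsilon> (t - int i) x < 0))
                 * ln ((\<epsilon> (t - int i) x)\<^sup>2))
            + (\<Sum>j = 1..p. \<beta> j * ln ((\<sigma> (t - int j) x)\<^sup>2)))"

definition stationary_solution ::
    "'a measure \<Rightarrow> (int \<Rightarrow> 'a \<Rightarrow> real) \<Rightarrow> nat \<Rightarrow> nat \<Rightarrow> real \<Rightarrow>
     (nat \<Rightarrow> real) \<Rightarrow> (nat \<Rightarrow> real) \<Rightarrow> (nat \<Rightarrow> real) \<Rightarrow>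
     (int \<Rightarrow> 'a \<Rightarrow> real) \<Rightarrow> (int \<Rightarrow> 'a \<Rightarrow> real) \<Rightarrow> bool" where
  "stationary_solution M \<eta> p q \<omega> \<alpha>p \<alpha>m \<beta> \<epsilon> \<sigma> \<longleftrightarrow>
     strictly_stationary M borel (\<lambda>t x. (\<epsilon> t x, \<sigma> t x)) \<and>
     log_garch_equations M \<eta> p q \<omega> \<alpha>p \<alpha>m \<beta> \<epsilon> \<sigma>"

end

theory Submission
  imports Defs
begin

text \<open>
  Collecting \<open>1{\<epsilon> > 0} log \<epsilon>\<^sup>2\<close>, \<open>1{\<epsilon> < 0} log \<epsilon>\<^sup>2\<close> and \<open>log \<sigma>\<^sup>2\<close> at the last times in a vector \<open>z\<^sub>t\<close>
  turns the model into \<open>z\<^sub>t = C\<^sub>t z\<^sub>t\<^sub>-\<^sub>1 + b\<^sub>t\<close> with iid coefficients.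
  Since \<open>C\<^sub>t\<close> takes finitely many values, a negative exponent gives some \<open>T\<close> and a small \<open>\<delta> > 0\<close> with
  \<open>E \<parallel>C\<^sub>T \<dots> C\<^sub>1\<parallel>\<^sup>\<delta> < 1\<close>; independence makes these moments submultiplicative, so they decay
  geometrically, and by Markov's inequality and Borel-Cantelli the norms of the products decay
  exponentially almost surely. The logarithmic moment makes \<open>b\<^sub>t\<^sub>-\<^sub>n\<close> grow subexponentially, hence
  \<open>z\<^sub>t = \<Sum>n. C\<^sub>t \<dots> C\<^sub>t\<^sub>-\<^sub>n\<^sub>+\<^sub>1 b\<^sub>t\<^sub>-\<^sub>n\<close> converges. This is a shift-equivariant function of the innovations, which
  gives stationarity and, the iid shift being mixing, ergodicity. The difference of two
  stationary solutions solves the homogeneous recursion and is tight, hence zero.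
\<close>

text \<open>The subadditive ergodic theorem is the usual way from a negative exponent to almost sure
  decay. Moments replace it here, and this also settles a mismatch of directions: the exponent
  concerns products that grow into the future, while the series for \<open>z\<close> needs products
  with a fixed left end that grow into the past. For each length the two have the same law, and
  Borel-Cantelli only asks for summable probabilities, so bounds on moments transfer at once. Two
  obstacles shape the moment step. The exponent is a limit, from which one finite time with negative
  expected logarithm has to be extracted. And a product may vanish with positive probability, which
  makes the expected logarithm minus infinity although the real \<open>ln 0\<close> is 0; small
  powers treat this case together with the regular one. For uniqueness, a competing solution comes
  with no moments, and two solutions need not be jointly stationary, so their difference need not be
  stationary. Tightness holds for each of them separately and passes to the difference.\<close>

section \<open>Independent identically distributed processes\<close>

text \<open>The events \<open>E\<close> with the stated limit form a Dynkin system, so a generating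
  pi-system is enough. In \<open>mixing\<close> this is applied twice, once with \<open>T n\<close>
  a shift into the future and once with a shift into the past.\<close>

lemma (in prob_space) asymptotic_independence_extend:
  assumes G: "Int_stable G" "G \<subseteq> Pow (space M)" "sets M = sigma_sets (space M) G"
    and T: "\<And>n. T n \<in> sets M" "\<And>n. prob (T n) = c"
    and base: "\<And>E. E \<in> G \<Longrightarrow> (\<lambda>n::nat. prob (E \<inter> T n)) \<longlonglongrightarrow> prob E * c"
    and E: "E \<in> sets M"
  shows "(\<lambda>n. prob (E \<inter> T n)) \<longlonglongrightarrow> prob E * c"
proof -
  note [measurable] = T(1)
  have E': "E \<in> sigma_sets (space M) G"
    using E G(3) by simp
  show ?thesis
    using E'
  proof (induct rule: sigma_sets_induct_disjoint[OF G(1,2), consumes 1, case_names basic empty compl union])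
    case (basic A)
    then show ?case by (rule base)
  next
    case empty
    then show ?case by simp
  next
    case (compl A)
    then have A: "A \<in> sets M" using G(3) by simp
    have "prob ((space M - A) \<inter> T n) = c - prob (A \<inter> T n)" for n
    proof -
      have "(space M - A) \<inter> T n = T n - A \<inter> T n"
        using sets.sets_into_space[OF T(1), of n] by auto
      then show ?thesis
        using A T by (simp add: finite_measure_Diff)
    qed
    moreover have "prob (space M - A) * c = c - prob A * c"
      using A by (simp add: prob_compl algebra_simps)
    ultimately show ?case
      using compl by (auto intro!: tendsto_intros)
  next
    case (union A)
    then have A: "range A \<subseteq> sets M" using G(3) by auto
    then have A': "A i \<in> sets M" for i by auto
    have 1: "(\<lambda>i. prob (A i \<inter> T n)) sums prob ((\<Union>i. A i) \<inter> T n)" for n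
    proof -
      have "disjoint_family (\<lambda>i. A i \<inter> T n)"
        using union(1) by (auto simp: disjoint_family_on_def)
      then have "(\<lambda>i. prob (A i \<inter> T n)) sums prob (\<Union>i. A i \<inter> T n)"
        using A' by (intro finite_measure_UNION) auto
      then show ?thesis by (simp add: Int_UN_distrib2)
    qed
    have 2: "(\<lambda>i. prob (A i)) sums prob (\<Union>i. A i)"
      using union(1) A by (intro finite_measure_UNION) auto
    have "(\<lambda>n. \<Sum>i. prob (A i \<inter> T n)) \<longlonglongrightarrow> (\<Sum>i. prob (A i) * c)"
    \<comment> \<open>Limit and series may be exchanged because the summable
      \<open>prob (A k)\<close> dominates uniformly in \<open>n\<close>.\<close>
    proof (rule tannerys_theorem[THEN conjunct2, THEN conjunct2])
      show "(\<lambda>n. prob (A k \<inter> T n)) \<longlonglongrightarrow> prob (A k) * c" for k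
        by (rule union)
      show "\<forall>\<^sub>F (k, n) in sequentially \<times>\<^sub>F sequentially. norm (prob (A k \<inter> T n)) \<le> prob (A k)"
        using A' by (intro always_eventually) (auto intro!: finite_measure_mono)
      show "summable (\<lambda>i. prob (A i))" using 2 by (rule sums_summable)
    qed simp
    moreover have "(\<Sum>i. prob (A i \<inter> T n)) = prob ((\<Union>i. A i) \<inter> T n)" for n
      using 1[of n] by (simp add: sums_iff)
    moreover have "(\<Sum>i. prob (A i) * c) = prob (\<Union>i. A i) * c"
      using sums_mult2[OF 2, of c] by (simp add: sums_iff)
    ultimately show ?case by simp
  qed
qed

section \<open>Path space, its shift, and mixing of iid sequences\<close>

definition shift :: "int \<Rightarrow> (int \<Rightarrow> 'b) \<Rightarrow> int \<Rightarrow> 'b" where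
  "shift k h = (\<lambda>t. h (t + k))"

lemma shift_apply [simp]: "shift k h t = h (t + k)"
  by (simp add: shift_def)

lemma shift_shift [simp]: "shift k (shift l h) = shift (k + l) h"
  by (simp add: shift_def fun_eq_iff algebra_simps)

lemma shift_0 [simp]: "shift 0 h = h"
  by (simp add: shift_def)

lemma measurable_shift [measurable]:
  "shift k \<in> (\<Pi>\<^sub>M t\<in>UNIV. N) \<rightarrow>\<^sub>M (\<Pi>\<^sub>M t\<in>UNIV. N)"
  unfolding shift_def by (rule measurable_PiM_single') (auto simp: space_PiM)

locale iid_process = prob_space M for M :: "'a measure" +
  fixes N :: "'b measure" and X :: "int \<Rightarrow> 'a \<Rightarrow> 'b"
  assumes iid: "iid M N X"
begin

definition path :: "'a \<Rightarrow> int \<Rightarrow> 'b" where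
  "path x = (\<lambda>t. X t x)"

abbreviation PS :: "(int \<Rightarrow> 'b) measure" where
  "PS \<equiv> (\<Pi>\<^sub>M t\<in>UNIV. N)"

lemma indep: "indep_vars (\<lambda>_. N) X UNIV"
  and distr_eq: "distr M N (X s) = distr M N (X t)"
  using iid by (auto simp: iid_def identically_distributed_def)

lemma X_measurable [measurable]: "X t \<in> M \<rightarrow>\<^sub>M N"
  using indep by (auto simp: indep_vars_def)

lemma path_measurable [measurable]: "path \<in> M \<rightarrow>\<^sub>M PS"
  unfolding path_def
  by (intro measurable_PiM_single') (auto intro: measurable_space[OF X_measurable])

lemma indep_shifted: "indep_vars (\<lambda>_. N) (\<lambda>t. X (t + k)) UNIV"
  unfolding indep_vars_def2
proof (intro conjI ballI)
  show "X (t + k) \<in> M \<rightarrow>\<^sub>M N" for t by measurable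
  have ind: "indep_sets (\<lambda>i. {X i -` A \<inter> space M |A. A \<in> sets N}) UNIV"
    using indep by (simp add: indep_vars_def2)
  have *: "prob (\<Inter>j\<in>J. A j) = (\<Prod>j\<in>J. prob (A j))"
    if "J \<noteq> {}" "finite J" "\<forall>j\<in>J. A j \<in> {X j -` A \<inter> space M |A. A \<in> sets N}" for J A
    by (rule indep_setsD[OF ind _ that(1,2,3)]) simp
  show "indep_sets (\<lambda>i. {X (i + k) -` A \<inter> space M |A. A \<in> sets N}) UNIV"
  proof (rule indep_setsI)
    fix A J assume J: "J \<noteq> {}" "finite J" and A: "\<forall>j\<in>J. A j \<in> {X (j + k) -` A \<inter> space M |A. A \<in> sets N}"
    have inj: "inj_on (\<lambda>j. j + k) J" by (auto simp: inj_on_def)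
    have "prob (\<Inter>j\<in>(\<lambda>j. j + k) ` J. A (j - k)) = (\<Prod>j\<in>(\<lambda>j. j + k) ` J. prob (A (j - k)))"
      using J A by (intro *) auto
    then show "prob (\<Inter>j\<in>J. A j) = (\<Prod>j\<in>J. prob (A j))"
      by (simp add: prod.reindex[OF inj] image_image)
  qed auto
qed

text \<open>By independence both laws are products of marginals, and the marginals do not depend on
  time.\<close>

lemma distr_shift_path: "distr M PS (\<lambda>x. shift k (path x)) = distr M PS path"
proof -
  have "distr M PS (\<lambda>x. \<lambda>i\<in>UNIV. X (i + k) x) = (\<Pi>\<^sub>M i\<in>UNIV. distr M N (X (i + k)))"
    using indep_shifted by (subst (asm) indep_vars_iff_distr_eq_PiM) auto
  also have "\<dots> = (\<Pi>\<^sub>M i\<in>UNIV. distr M N (X i))"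
    using distr_eq by (intro PiM_cong) auto
  also have "\<dots> = distr M PS (\<lambda>x. \<lambda>i\<in>UNIV. X i x)"
    using indep by (subst (asm) indep_vars_iff_distr_eq_PiM) auto
  finally show ?thesis
    by (simp add: path_def[abs_def] shift_def restrict_def)
qed

lemma shift_invariant_integral:
  fixes f :: "(int \<Rightarrow> 'b) \<Rightarrow> 'c :: {banach, second_countable_topology}"
  assumes [measurable]: "f \<in> borel_measurable PS"
  shows "(\<integral>x. f (shift k (path x)) \<partial>M) = (\<integral>x. f (path x) \<partial>M)"
proof -
  have "(\<integral>x. f (shift k (path x)) \<partial>M) = (\<integral>h. f h \<partial>distr M PS (\<lambda>x. shift k (path x)))"
    by (subst integral_distr) auto
  then show ?thesis
    by (simp add: distr_shift_path integral_distr)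
qed

lemma shift_invariant_prob:
  assumes [measurable]: "Measurable.pred PS Q"
  shows "prob {x \<in> space M. Q (shift k (path x))} = prob {x \<in> space M. Q (path x)}"
proof -
  have "prob {x \<in> space M. Q (shift k (path x))} =
      measure (distr M PS (\<lambda>x. shift k (path x))) {h \<in> space PS. Q h}"
    by (subst measure_distr)
      (auto intro!: arg_cong[where f=prob] measurable_space[OF measurable_shift] dest: measurable_space[OF path_measurable])
  also have "\<dots> = prob {x \<in> space M. Q (path x)}"
    unfolding distr_shift_path
    by (subst measure_distr) (auto intro!: arg_cong[where f=prob] dest: measurable_space[OF path_measurable])
  finally show ?thesis .
qed

text \<open>Cylinders look at finitely many coordinates; a large enough shift makes the two
  coordinate sets disjoint.\<close>

lemma cylinder_eventually_indep:
  assumes E: "E \<in> prod_algebra UNIV (\<lambda>_::int. N)" and F: "F \<in> prod_algebra UNIV (\<lambda>_::int. N)"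
  shows "\<forall>\<^sub>F n::nat in sequentially.
    prob {x \<in> space M. path x \<in> E \<and> shift (int n) (path x) \<in> F} =
    prob {x \<in> space M. path x \<in> E} * prob {x \<in> space M. shift (int n) (path x) \<in> F}"
proof -
  obtain J A where E: "E = prod_emb UNIV (\<lambda>_. N) J (Pi\<^sub>E J A)" "finite J" "\<And>i. i \<in> J \<Longrightarrow> A i \<in> sets N"
    using prod_algebraE[OF E] by metis
  obtain K B where F: "F = prod_emb UNIV (\<lambda>_. N) K (Pi\<^sub>E K B)" "finite K" "\<And>i. i \<in> K \<Longrightarrow> B i \<in> sets N"
    using prod_algebraE[OF F] by metis
  have PJ: "Pi\<^sub>E J A \<in> sets (PiM J (\<lambda>_. N))" using E by (intro sets_PiM_I_finite) auto
  \<comment> \<open>Beyond \<open>max J - min K\<close> every shifted element of \<open>K\<close>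
    lies to the right of \<open>J\<close>. Inserting 0 keeps \<open>Max\<close> and
    \<open>Min\<close> meaningful for empty sets, and the final 1 makes the separation
    strict.\<close>
  define n0 where "n0 = nat (Max (insert 0 J) - Min (insert 0 K)) + 1"
  show ?thesis
  proof (rule eventually_sequentiallyI[of n0])
    fix n assume n: "n0 \<le> n"
    define K' where "K' = (\<lambda>k. k + int n) ` K"
    have disj: "J \<inter> K' = {}"
    proof (rule ccontr)
      assume "J \<inter> K' \<noteq> {}"
      then obtain k where k: "k \<in> K" "k + int n \<in> J" by (auto simp: K'_def)
      have "k + int n \<le> Max (insert 0 J)" "Min (insert 0 K) \<le> k"
        using k E F by (auto intro!: Max_ge Min_le)
      then show False using n unfolding n0_def by linarith
    qed
    have PK: "Pi\<^sub>E K' (\<lambda>m. B (m - int n)) \<in> sets (PiM K' (\<lambda>_. N))"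
      using F by (intro sets_PiM_I_finite) (auto simp: K'_def)
    have "prob ((\<lambda>x. (restrict (path x) J, restrict (path x) K')) -`
          (Pi\<^sub>E J A \<times> Pi\<^sub>E K' (\<lambda>m. B (m - int n))) \<inter> space M)
        = prob ((\<lambda>x. restrict (path x) J) -` Pi\<^sub>E J A \<inter> space M)
          * prob ((\<lambda>x. restrict (path x) K') -` Pi\<^sub>E K' (\<lambda>m. B (m - int n)) \<inter> space M)"
      using indep_var_restrict[OF indep disj] PJ PK unfolding path_def
      by (intro indep_varD) auto
    moreover have "restrict (path x) J \<in> Pi\<^sub>E J A \<longleftrightarrow> path x \<in> E" if "x \<in> space M" for x
      using that measurable_space[OF path_measurable, of x]
      by (auto simp: E(1) prod_emb_def space_PiM)
    moreover have "restrict (path x) K' \<in> Pi\<^sub>E K' (\<lambda>m. B (m - int n)) \<longleftrightarrow> shift (int n) (path x) \<in> F"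
      if "x \<in> space M" for x
      using that measurable_space[OF path_measurable, of x]
      by (auto simp: F(1) prod_emb_def space_PiM K'_def PiE_iff)
    ultimately show "prob {x \<in> space M. path x \<in> E \<and> shift (int n) (path x) \<in> F} =
      prob {x \<in> space M. path x \<in> E} * prob {x \<in> space M. shift (int n) (path x) \<in> F}"
      by (simp add: vimage_def Int_def conj_commute cong: conj_cong)
  qed
qed

text \<open>Both events are extended from cylinders to the generated sigma-algebra, one after
  the other; stationarity moves the shift from the second event to the first.\<close>

lemma mixing:
  assumes E: "E \<in> sets PS" and F: "F \<in> sets PS"
  shows "(\<lambda>n. prob {x \<in> space M. path x \<in> E \<and> shift (int n) (path x) \<in> F}) \<longlonglongrightarrow>
    prob {x \<in> space M. path x \<in> E} * prob {x \<in> space M. path x \<in> F}"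
proof -
  define D where "D = distr M PS path"
  interpret D: prob_space D unfolding D_def by (rule prob_space_distr) measurable
  have sD: "sets D = sets PS" and spD: "space D = space PS" by (auto simp: D_def)
  define T where "T k F = shift k -` F \<inter> space PS" for k and F :: "(int \<Rightarrow> 'b) set"
  have T: "T k F \<in> sets PS" if "F \<in> sets PS" for k F
    using that unfolding T_def by measurable
  have mD: "measure D F = prob {x \<in> space M. path x \<in> F}" if "F \<in> sets PS" for F
    using that unfolding D_def by (subst measure_distr) (auto intro!: arg_cong[where f=prob])
  have mDT: "measure D (E \<inter> T k F) = prob {x \<in> space M. path x \<in> E \<and> shift k (path x) \<in> F}"
    if "F \<in> sets PS" "E \<in> sets PS" for F k E
    using that T[of F] by (subst mD) (auto simp: T_def intro!: arg_cong[where f=prob] dest: measurable_space[OF path_measurable])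
  have inv: "measure D (T k F) = measure D F" if F[measurable]: "F \<in> sets PS" for k F
  proof -
    have "measure D (T k F) = prob {x \<in> space M. shift k (path x) \<in> F}"
      using that T[of F] by (subst mD) (auto simp: T_def intro!: arg_cong[where f=prob] dest: measurable_space[OF path_measurable])
    also have "\<dots> = prob {x \<in> space M. path x \<in> F}"
      by (rule shift_invariant_prob[OF pred_sets2[OF F measurable_ident_sets[OF refl]]])
    finally show ?thesis using that by (simp add: mD)
  qed
  have swap: "measure D (E \<inter> T k F) = measure D (F \<inter> T (- k) E)"
    if "F \<in> sets PS" "E \<in> sets PS" for F k E
  proof -
    have "T (- k) (E \<inter> T k F) = F \<inter> T (- k) E"
      using that[THEN sets.sets_into_space] measurable_space[OF measurable_shift, of _ N "-k"] by (fastforce simp: T_def)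
    then show ?thesis
      using inv[of "E \<inter> T k F" "- k"] that T[of F k] by simp
  qed
  let ?G = "prod_algebra UNIV (\<lambda>_::int. N)"
  have G: "Int_stable ?G" "?G \<subseteq> Pow (space D)" "sets D = sigma_sets (space D) ?G"
    using prod_algebra_sets_into_space[of UNIV "\<lambda>_. N"]
    by (auto simp: Int_stable_prod_algebra spD space_PiM sD sets_PiM)
  have GP: "E \<in> sets PS" if "E \<in> ?G" for E
    using that unfolding sets_PiM by (rule sigma_sets.Basic)
  have step1: "(\<lambda>n. measure D (E \<inter> T (int n) F)) \<longlonglongrightarrow> measure D E * measure D F"
    if "E \<in> sets PS" "F \<in> ?G" for E F
  proof (rule D.asymptotic_independence_extend[OF G])
    show "T (int n) F \<in> sets D" "measure D (T (int n) F) = measure D F" for n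
      using that T inv GP by (auto simp: sD)
    show "E \<in> sets D" using that by (simp add: sD)
    fix A assume A: "A \<in> ?G"
    have "\<forall>\<^sub>F n in sequentially. measure D (A \<inter> T (int n) F) = measure D A * measure D F"
      using cylinder_eventually_indep[OF A that(2)]
    proof eventually_elim
      case (elim n)
      have "prob {x \<in> space M. shift (int n) (path x) \<in> F} = prob {x \<in> space M. path x \<in> F}"
        by (rule shift_invariant_prob[OF pred_sets2[OF GP[OF that(2)] measurable_ident_sets[OF refl]]])
      then show ?case
        using elim that A GP by (simp add: mDT mD)
    qed
    then show "(\<lambda>n. measure D (A \<inter> T (int n) F)) \<longlonglongrightarrow> measure D A * measure D F"
      by (rule tendsto_eventually)
  qed
  \<comment> \<open>The roles are now exchanged: \<open>E\<close> is fixed and arbitrary,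
    \<open>F\<close> is the event being extended from cylinders, and \<open>swap\<close> turns
    \<open>step1\<close> into the base case.\<close>
  have "(\<lambda>n. measure D (F \<inter> T (- int n) E)) \<longlonglongrightarrow> measure D F * measure D E"
  proof (rule D.asymptotic_independence_extend[OF G])
    show "T (- int n) E \<in> sets D" "measure D (T (- int n) E) = measure D E" for n
      using E T inv by (auto simp: sD)
    show "F \<in> sets D" using F by (simp add: sD)
    show "(\<lambda>n. measure D (A \<inter> T (- int n) E)) \<longlonglongrightarrow> measure D A * measure D E" if "A \<in> ?G" for A
      using step1[OF E that] swap[OF GP[OF that] E] by (simp add: mult.commute)
  qed
  then show ?thesis
    using E F swap[OF F E, symmetric] by (simp add: mDT mD mult.commute)
qed

text \<open>Mixing of \<open>A\<close> with itself: the left side is constantly P(A) by invariance,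
  so P(A) equals its own square.\<close>

lemma shift_invariant_0_1:
  assumes A: "A \<in> sets PS" and inv: "shift 1 -` A \<inter> space PS = A"
  shows "prob {x \<in> space M. path x \<in> A} \<in> {0, 1}"
proof -
  have "shift (int n) h \<in> A \<longleftrightarrow> h \<in> A" if "h \<in> space PS" for h n
  proof (induction n)
    case (Suc n)
    have "shift (int n) h \<in> space PS"
      using measurable_space[OF measurable_shift] that by blast
    then have "shift 1 (shift (int n) h) \<in> A \<longleftrightarrow> shift (int n) h \<in> A"
      using inv by blast
    moreover have "shift 1 (shift (int n) h) = shift (int (Suc n)) h"
      by (simp add: fun_eq_iff algebra_simps)
    ultimately show ?case using Suc by metis
  qed simp
  then have "{x \<in> space M. path x \<in> A \<and> shift (int n) (path x) \<in> A} = {x \<in> space M. path x \<in> A}" for n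
    using measurable_space[OF path_measurable] by blast
  then have "(\<lambda>n::nat. prob {x \<in> space M. path x \<in> A}) \<longlonglongrightarrow>
      prob {x \<in> space M. path x \<in> A} * prob {x \<in> space M. path x \<in> A}"
    using mixing[OF A A] by simp
  then have "prob {x \<in> space M. path x \<in> A} =
      prob {x \<in> space M. path x \<in> A} * prob {x \<in> space M. path x \<in> A}"
    by (simp add: LIMSEQ_const_iff)
  then show ?thesis by auto
qed

text \<open>Equivariance moves the time shift onto the path, whose law is shift invariant.\<close>

lemma factor_strictly_stationary:
  assumes [measurable]: "\<And>t. F t \<in> PS \<rightarrow>\<^sub>M L"
    and equiv: "\<And>t k h. F (t + k) h = F t (shift k h)"
  shows "strictly_stationary M L (\<lambda>t x. F t (path x))"
  unfolding strictly_stationary_def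
proof (intro conjI allI impI)
  show "(\<lambda>x. F t (path x)) \<in> M \<rightarrow>\<^sub>M L" for t by measurable
  fix J :: "int set" and k :: int
  have m [measurable]: "(\<lambda>h. \<lambda>t\<in>J. F t h) \<in> PS \<rightarrow>\<^sub>M (\<Pi>\<^sub>M t\<in>J. L)"
    by (intro measurable_restrict) simp
  have "distr M (\<Pi>\<^sub>M t\<in>J. L) (\<lambda>x. \<lambda>t\<in>J. F (t + k) (path x)) =
      distr (distr M PS (\<lambda>x. shift k (path x))) (\<Pi>\<^sub>M t\<in>J. L) (\<lambda>h. \<lambda>t\<in>J. F t h)"
    by (subst distr_distr) (auto simp: comp_def equiv)
  also have "\<dots> = distr M (\<Pi>\<^sub>M t\<in>J. L) (\<lambda>x. \<lambda>t\<in>J. F t (path x))"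
    unfolding distr_shift_path by (subst distr_distr) (auto simp: comp_def)
  finally show "distr M (\<Pi>\<^sub>M t\<in>J. L) (\<lambda>x. \<lambda>t\<in>J. F (t + k) (path x)) =
      distr M (\<Pi>\<^sub>M t\<in>J. L) (\<lambda>x. \<lambda>t\<in>J. F t (path x))" .
qed

text \<open>The preimage of a shift-invariant event under an equivariant map is a shift-invariant
  event of the innovations, where the zero-one law is available.\<close>

lemma factor_ergodic:
  assumes [measurable]: "\<And>t. F t \<in> PS \<rightarrow>\<^sub>M L"
    and equiv: "\<And>t k h. F (t + k) h = F t (shift k h)"
  shows "ergodic_process M L (\<lambda>t x. F t (path x))"
  unfolding ergodic_process_def
proof (intro ballI impI)
  fix A assume A [measurable]: "A \<in> sets (\<Pi>\<^sub>M t\<in>UNIV. L)"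
    and inv: "(\<lambda>\<omega> t. \<omega> (t + 1)) -` A \<inter> space (\<Pi>\<^sub>M t\<in>(UNIV :: int set). L) = A"
  define \<Phi> where "\<Phi> h = (\<lambda>t. F t h)" for h
  have [measurable]: "\<Phi> \<in> PS \<rightarrow>\<^sub>M (\<Pi>\<^sub>M t\<in>UNIV. L)"
    unfolding \<Phi>_def
    by (intro measurable_PiM_single') (auto intro: measurable_space[OF assms(1)])
  define B where "B = \<Phi> -` A \<inter> space PS"
  have B: "B \<in> sets PS" unfolding B_def by measurable
  have \<Phi>: "\<Phi> h \<in> space (\<Pi>\<^sub>M t\<in>UNIV. L)" if "h \<in> space PS" for h
    using measurable_space[of \<Phi> PS "\<Pi>\<^sub>M t\<in>UNIV. L" h] that by simp
  have \<Phi>s: "\<Phi> (shift 1 h) = (\<lambda>t. \<Phi> h (t + 1))" for h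
    by (simp add: \<Phi>_def equiv)
  have "\<Phi> (shift 1 h) \<in> A \<longleftrightarrow> \<Phi> h \<in> A" if "h \<in> space PS" for h
    using inv \<Phi>[OF that] unfolding \<Phi>s by blast
  moreover have "shift 1 h \<in> space PS" if "h \<in> space PS" for h
    using measurable_space[OF measurable_shift] that by blast
  ultimately have "shift 1 -` B \<inter> space PS = B"
    by (auto simp: B_def)
  from shift_invariant_0_1[OF B this]
  have "prob {x \<in> space M. path x \<in> B} \<in> {0, 1}" .
  moreover have "{x \<in> space M. path x \<in> B} = {x \<in> space M. (\<lambda>t. F t (path x)) \<in> A}"
    using measurable_space[OF path_measurable] by (auto simp: B_def \<Phi>_def)
  ultimately show "prob {x \<in> space M. (\<lambda>t. F t (path x)) \<in> A} \<in> {0, 1}" by simp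
qed

end

section \<open>Real-analytic and measure-theoretic preliminaries\<close>

text \<open>For negative x = -y the bound follows from (1 - y + y^2) e^y >= 1, where e^y is replaced
  by its quadratic Taylor polynomial.\<close>

lemma exp_le_quadratic:
  fixes x :: real
  assumes "\<bar>x\<bar> \<le> 1"
  shows "exp x \<le> 1 + x + x\<^sup>2"
proof (cases "0 \<le> x")
  case True
  then show ?thesis using exp_bound[of x] assms by simp
next
  case False
  define y where "y = - x"
  have y: "0 \<le> y" using False by (simp add: y_def)
  have "1 \<le> (1 - y + y\<^sup>2) * (1 + y + y\<^sup>2 / 2)"
  proof -
    have "(1 - y + y\<^sup>2) * (1 + y + y\<^sup>2 / 2) = 1 + y\<^sup>2 / 2 + y ^ 3 / 2 + y ^ 4 / 2"
      by (simp add: field_simps power2_eq_square power3_eq_cube power4_eq_xxxx)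
    then show ?thesis using y by simp
  qed
  also have "\<dots> \<le> (1 - y + y\<^sup>2) * exp y"
    using exp_lower_Taylor_quadratic[OF y] assms y
    by (intro mult_left_mono) (auto simp: y_def)
  finally have "exp (- y) \<le> 1 - y + y\<^sup>2"
    by (simp add: exp_minus field_simps)
  then show ?thesis by (simp add: y_def)
qed

text \<open>Nonnegativity bounds the infimum of \<open>u n / n\<close> from below, so the limit is
  real, and it also gives its sign. Index 0 is left out because in the application the terms are
  only known to be expected logarithms for \<open>n \<ge> 1\<close>.\<close>

lemma fekete_nonneg:
  fixes u :: "nat \<Rightarrow> real"
  assumes sub: "\<And>m n. 1 \<le> m \<Longrightarrow> 1 \<le> n \<Longrightarrow> u (m + n) \<le> u m + u n"
    and nonneg: "\<And>n. 1 \<le> n \<Longrightarrow> 0 \<le> u n"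
  obtains L where "0 \<le> L" "(\<lambda>n. u n / real n) \<longlonglongrightarrow> L"
proof
  define L where "L = (INF n\<in>{1..}. u n / real n)"
  have bdd: "bdd_below ((\<lambda>n. u n / real n) ` {1..})"
    using nonneg by (intro bdd_belowI2[of _ 0]) auto
  show "0 \<le> L"
    unfolding L_def using nonneg by (intro cINF_greatest) auto
  have lower: "L \<le> u n / real n" if "1 \<le> n" for n
    unfolding L_def using that bdd by (intro cINF_lower) auto
  show "(\<lambda>n. u n / real n) \<longlonglongrightarrow> L"
  proof (rule LIMSEQ_I)
    fix e :: real assume e: "0 < e"
    have "\<exists>n\<in>{1..}. u n / real n < L + e / 2"
      using cINF_less_iff[of "{1..}" "\<lambda>n. u n / real n" "L + e / 2"] bdd e by (auto simp: L_def)
    then obtain m where m: "1 \<le> m" "u m / real m < L + e / 2" by auto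
    define C where "C = (\<Sum>r\<le>m. \<bar>u r\<bar>)"
    have C: "u r \<le> C" if "r \<le> m" for r
    proof -
      have "\<bar>u r\<bar> \<le> C"
        unfolding C_def using that by (intro member_le_sum) auto
      then show ?thesis by linarith
    qed
    have C0: "0 \<le> C" by (auto simp: C_def intro!: sum_nonneg)
    \<comment> \<open>Remainders run through 1..m instead of 0..m-1, since subadditivity is only
      available for positive indices.\<close>
    have step: "u (k * m + r) \<le> real k * u m + C" if "1 \<le> r" "r \<le> m" for k r
    proof (induction k)
      case 0
      then show ?case using C[OF that(2)] by simp
    next
      case (Suc k)
      have "u (m + (k * m + r)) \<le> u m + u (k * m + r)"
        using that m by (intro sub) auto
      then show ?case using Suc by (simp add: algebra_simps)
    qed
    have upper: "u n / real n \<le> u m / real m + C / real n" if "1 \<le> n" for n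
    proof -
      define k where "k = (n - 1) div m"
      define r where "r = (n - 1) mod m + 1"
      have n: "n = k * m + r"
        using that m by (simp add: k_def r_def)
      have r: "1 \<le> r" "r \<le> m"
        using m by (auto simp: r_def Suc_leI)
      \<comment> \<open>Since \<open>u m\<close> is nonnegative, the number \<open>k\<close> of full
        blocks may be enlarged to \<open>n / m\<close>.\<close>
      have "real k * u m \<le> real n * (u m / real m)"
      proof -
        have "real k \<le> real n / real m"
          using m n by (simp add: field_simps flip: of_nat_mult of_nat_add)
        then have "real k * u m \<le> real n / real m * u m"
          using nonneg[OF m(1)] by (rule mult_right_mono)
        then show ?thesis by simp
      qed
      then have "u n \<le> real n * (u m / real m) + C"
        using step[OF r, of k] n by simp
      then show ?thesis using that by (simp add: field_simps)
    qed
    obtain n0 where n0: "2 * C / e < real n0" using reals_Archimedean2 by blast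
    show "\<exists>no. \<forall>n\<ge>no. norm (u n / real n - L) < e"
    proof (intro exI[of _ "max 1 n0"] allI impI)
      fix n assume n: "max 1 n0 \<le> n"
      then have "C / real n < e / 2"
        using n0 e by (simp add: field_simps) (smt (verit) mult_left_mono of_nat_mono)
      moreover have "u n / real n \<le> u m / real m + C / real n" using upper[of n] n by simp
      ultimately have "u n / real n < L + e" using m(2) by linarith
      then show "norm (u n / real n - L) < e"
        using lower[of n] n by (simp add: abs_less_iff)
    qed
  qed
qed

text \<open>At each point at most \<open>1 + X x / c\<close> indices satisfy
  \<open>c * real n < X x\<close>; integrating this count bounds all partial sums.\<close>

lemma (in prob_space) tail_probabilities_summable:
  fixes X :: "'a \<Rightarrow> real"
  assumes X: "integrable M X" "\<And>x. x \<in> space M \<Longrightarrow> 0 \<le> X x" and c: "0 < c"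
  shows "summable (\<lambda>n. prob {x \<in> space M. c * real n < X x})"
proof (rule bounded_imp_summable)
  have [measurable]: "X \<in> borel_measurable M" using X by auto
  fix N :: nat
  let ?A = "\<lambda>n. {x \<in> space M. c * real n < X x}"
  have bound: "(\<Sum>n\<le>N. indicator (?A n) x) \<le> 1 + X x / c" if "x \<in> space M" for x
  proof -
    have "(\<Sum>n\<le>N. indicator (?A n) x) = real (card {n \<in> {..N}. c * real n < X x})"
      using that by (simp add: indicator_def of_bool_def sum.If_cases Int_def)
    also have "\<dots> \<le> real (card {..nat \<lfloor>X x / c\<rfloor>})"
    proof (intro of_nat_mono card_mono)
      show "{n \<in> {..N}. c * real n < X x} \<subseteq> {..nat \<lfloor>X x / c\<rfloor>}"
      proof clarsimp
        fix n assume "c * real n < X x"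
        then have "real n \<le> X x / c" using c by (simp add: field_simps)
        then show "n \<le> nat \<lfloor>X x / c\<rfloor>" by linarith
      qed
    qed simp
    also have "\<dots> \<le> 1 + X x / c"
      using X(2)[OF that] c by simp
    finally show ?thesis .
  qed
  have "(\<Sum>n\<le>N. prob (?A n)) = (\<integral>x. (\<Sum>n\<le>N. indicator (?A n) x) \<partial>M)"
    by (subst Bochner_Integration.integral_sum) (auto simp: Int_absorb2 subset_eq emeasure_eq_measure intro!: integrable_real_indicator)
  also have "\<dots> \<le> (\<integral>x. 1 + X x / c \<partial>M)"
    using X bound
    by (intro integral_mono)
      (auto simp: emeasure_eq_measure intro!: integrable_real_indicator Bochner_Integration.integrable_sum)
  finally show "(\<Sum>n\<le>N. prob (?A n)) \<le> (\<integral>x. 1 + X x / c \<partial>M)" .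
qed simp

lemma (in prob_space) AE_eventually_not:
  fixes P :: "nat \<Rightarrow> 'a \<Rightarrow> bool"
  assumes [measurable]: "\<And>n. Measurable.pred M (P n)"
    and "summable (\<lambda>n. prob {x \<in> space M. P n x})"
  shows "AE x in M. \<forall>\<^sub>F n in sequentially. \<not> P n x"
proof -
  have "AE x in M. \<forall>\<^sub>F n in sequentially. x \<in> space M - {x \<in> space M. P n x}"
    using assms(2) by (intro borel_cantelli_AE1) (auto simp: emeasure_eq_measure)
  then show ?thesis
    by eventually_elim (auto elim: eventually_mono)
qed

section \<open>Logarithmic expectations and small positive moments\<close>

lemma elog_ereal_pos: "0 < y \<Longrightarrow> elog (ereal y) = ereal (ln y)"
  by (simp add: elog_def)

lemma elog_ereal_nonpos: "y \<le> 0 \<Longrightarrow> elog (ereal y) = -\<infinity>"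
  by (simp add: elog_def)

lemma ext_expectation_ereal:
  assumes f: "integrable M f" and g: "AE x in M. g x = ereal (f x)"
  shows "ext_expectation M g = ereal (\<integral>x. f x \<partial>M)"
proof -
  have 1: "(\<integral>\<^sup>+ x. e2ennreal (g x) \<partial>M) = (\<integral>\<^sup>+ x. ennreal (f x) \<partial>M)"
    using g by (intro nn_integral_cong_AE) (auto simp: e2ennreal_ereal)
  have 2: "(\<integral>\<^sup>+ x. e2ennreal (- g x) \<partial>M) = (\<integral>\<^sup>+ x. ennreal (- f x) \<partial>M)"
    using g by (intro nn_integral_cong_AE) (auto simp: e2ennreal_ereal)
  have 3: "(\<integral>\<^sup>+ x. ennreal (f x) \<partial>M) < \<infinity>" "(\<integral>\<^sup>+ x. ennreal (- f x) \<partial>M) < \<infinity>"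
    using f by (auto simp: real_integrable_def top.not_eq_extremum)
  then show ?thesis
    unfolding ext_expectation_def 1 2 real_lebesgue_integral_def[OF f]
    by (cases "\<integral>\<^sup>+ x. ennreal (f x) \<partial>M"; cases "\<integral>\<^sup>+ x. ennreal (- f x) \<partial>M")
      (auto simp: enn2ereal_ennreal)
qed

lemma (in prob_space) ext_expectation_elog_eq_ln:
  fixes Y :: "'a \<Rightarrow> real"
  assumes "integrable M (\<lambda>x. ln (Y x))" "AE x in M. 0 < Y x"
  shows "ext_expectation M (\<lambda>x. elog (ereal (Y x))) = ereal (\<integral>x. ln (Y x) \<partial>M)"
  using assms by (intro ext_expectation_ereal) (auto simp: elog_ereal_pos)

text \<open>The zero set makes the negative part infinite. The positive part is dominated by that of
  the real \<open>ln (Y x)\<close>, hence finite, and no difference of infinities occurs.\<close>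

lemma (in prob_space) ext_expectation_elog_eq_MInfty:
  fixes Y :: "'a \<Rightarrow> real"
  assumes int: "integrable M (\<lambda>x. ln (Y x))" and [measurable]: "Y \<in> borel_measurable M"
    and nonneg: "\<And>x. 0 \<le> Y x" and null: "\<not> (AE x in M. 0 < Y x)"
  shows "ext_expectation M (\<lambda>x. elog (ereal (Y x))) = -\<infinity>"
proof -
  let ?Z = "{x \<in> space M. Y x = 0}"
  have "emeasure M ?Z \<noteq> 0"
  proof
    assume "emeasure M ?Z = 0"
    then have "AE x in M. Y x \<noteq> 0" by (subst AE_iff_measurable[OF _ refl]) auto
    then have "AE x in M. 0 < Y x"
      using nonneg by (auto simp: less_le)
    then show False using null by simp
  qed
  then have "\<infinity> = (\<integral>\<^sup>+ x. \<infinity> * indicator ?Z x \<partial>M)"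
    by (subst nn_integral_cmult_indicator) (auto simp: ennreal_top_mult)
  also have "\<dots> \<le> (\<integral>\<^sup>+ x. e2ennreal (- elog (ereal (Y x))) \<partial>M)"
    by (intro nn_integral_mono) (auto simp: indicator_def elog_ereal_nonpos)
  finally have neg: "(\<integral>\<^sup>+ x. e2ennreal (- elog (ereal (Y x))) \<partial>M) = \<infinity>"
    by (simp add: top_unique)
  have "(\<integral>\<^sup>+ x. e2ennreal (elog (ereal (Y x))) \<partial>M) \<le> (\<integral>\<^sup>+ x. ennreal (ln (Y x)) \<partial>M)"
  proof (intro nn_integral_mono)
    fix x
    show "e2ennreal (elog (ereal (Y x))) \<le> ennreal (ln (Y x))"
      using nonneg[of x] by (cases "Y x = 0") (auto simp: elog_ereal_pos elog_ereal_nonpos e2ennreal_neg)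
  qed
  also have "\<dots> < \<infinity>"
    using int by (auto simp: real_integrable_def top.not_eq_extremum)
  finally show ?thesis
    unfolding ext_expectation_def neg by (cases "\<integral>\<^sup>+ x. e2ennreal (elog (ereal (Y x))) \<partial>M") (auto simp: enn2ereal_ennreal)
qed

text \<open>The map \<delta> \<mapsto> E exp(\<delta> L) is 1 at 0 with derivative E L < 0. The
  quadratic bound on the exponential makes this quantitative.\<close>

lemma (in prob_space) exp_moment_less_1:
  fixes L :: "'a \<Rightarrow> real"
  assumes [measurable]: "L \<in> borel_measurable M" and C: "\<And>x. x \<in> space M \<Longrightarrow> \<bar>L x\<bar> \<le> C"
    and neg: "(\<integral>x. L x \<partial>M) < 0"
  obtains \<delta> where "0 < \<delta>" "(\<integral>x. exp (\<delta> * L x) \<partial>M) < 1"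
proof -
  define C' where "C' = max C 1"
  have C': "\<bar>L x\<bar> \<le> C'" if "x \<in> space M" for x using C[OF that] by (simp add: C'_def)
  have C'1: "1 \<le> C'" by (simp add: C'_def)
  define m where "m = - (\<integral>x. L x \<partial>M)"
  have m: "0 < m" using neg by (simp add: m_def)
  have intL: "integrable M L" using C by (intro integrable_const_bound[of _ C]) auto
  \<comment> \<open>The first bound keeps \<open>\<delta> * L x\<close> in [-1, 1], where the
    quadratic estimate applies; the second makes the quadratic error at most half of the linear gain
    \<open>\<delta> * m\<close>.\<close>
  define \<delta> where "\<delta> = min (1 / C') (m / (2 * C'\<^sup>2))"
  have \<delta>: "0 < \<delta>" "\<delta> \<le> 1 / C'" "\<delta> \<le> m / (2 * C'\<^sup>2)"
    using m C'1 by (auto simp: \<delta>_def)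
  have \<delta>L: "\<bar>\<delta> * L x\<bar> \<le> \<delta> * C'" if "x \<in> space M" for x
    using \<delta>(1) C'[OF that] by (simp add: abs_mult)
  have \<delta>C: "\<delta> * C' \<le> 1" using \<delta>(2) C'1 by (simp add: field_simps)
  have "exp (\<delta> * L x) \<le> 1 + \<delta> * L x + (\<delta> * C')\<^sup>2" if "x \<in> space M" for x
  proof -
    have "(\<delta> * L x)\<^sup>2 \<le> (\<delta> * C')\<^sup>2"
      using \<delta>L[OF that] \<delta>(1) C'1 by (intro abs_le_square_iff[THEN iffD1]) simp
    then show ?thesis
      using exp_le_quadratic[of "\<delta> * L x"] \<delta>L[OF that] \<delta>C by linarith
  qed
  then have "(\<integral>x. exp (\<delta> * L x) \<partial>M) \<le> (\<integral>x. 1 + \<delta> * L x + (\<delta> * C')\<^sup>2 \<partial>M)"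
  proof (intro integral_mono)
    show "integrable M (\<lambda>x. exp (\<delta> * L x))"
      using \<delta>L by (intro integrable_const_bound[of _ "exp (\<delta> * C')"]) (auto simp: abs_le_iff)
  qed (use intL in auto)
  also have "\<dots> = 1 - \<delta> * m + (\<delta> * C')\<^sup>2"
    using intL by (simp add: m_def prob_space)
  also have "\<dots> < 1"
  proof -
    have "\<delta> * C'\<^sup>2 < m"
      using \<delta>(3) C'1 m by (simp add: field_simps)
    then have "\<delta> * (\<delta> * C'\<^sup>2) < \<delta> * m"
      using \<delta>(1) by (rule mult_strict_left_mono)
    then show ?thesis by (simp add: power2_eq_square algebra_simps)
  qed
  finally show thesis using that \<delta>(1) by blast
qed

text \<open>The expected logarithm may be negative only because \<open>Y\<close> vanishes with
  positive probability, which the real \<open>ln\<close> with \<open>ln 0 = 0\<close> does not see.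
  A finite penalty \<open>k\<close> on the zero set replaces minus infinity and keeps the exponent
  bounded.\<close>

lemma (in prob_space) powr_moment_less_1:
  fixes Y :: "'a \<Rightarrow> real"
  assumes [measurable]: "Y \<in> borel_measurable M" and nonneg: "\<And>x. 0 \<le> Y x"
    and C: "\<And>x. x \<in> space M \<Longrightarrow> \<bar>ln (Y x)\<bar> \<le> C"
    and neg: "ext_expectation M (\<lambda>x. elog (ereal (Y x))) < 0"
  obtains \<delta> where "0 < \<delta>" "(\<integral>x. Y x powr \<delta> \<partial>M) < 1"
proof -
  have int: "integrable M (\<lambda>x. ln (Y x))"
    using C by (intro integrable_const_bound[of _ C]) auto
  define p0 where "p0 = prob {x \<in> space M. Y x = 0}"
  \<comment> \<open>If the zero set is null, \<open>ln (Y x)\<close> already has negative mean and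
    \<open>k = 0\<close> works; otherwise a large penalty pushes the mean below 0.\<close>
  have "\<exists>k\<ge>0. (\<integral>x. ln (Y x) \<partial>M) - k * p0 < 0"
  proof (cases "p0 = 0")
    case True
    then have "AE x in M. Y x \<noteq> 0"
      unfolding p0_def by (subst AE_iff_measurable[OF _ refl]) (auto simp: emeasure_eq_measure)
    then have "AE x in M. 0 < Y x" using nonneg by (auto simp: less_le)
    then show ?thesis
      using neg ext_expectation_elog_eq_ln[OF int] by auto
  next
    case False
    then have "0 < p0" by (simp add: p0_def measure_nonneg less_le)
    then show ?thesis
      by (intro exI[of _ "(\<bar>\<integral>x. ln (Y x) \<partial>M\<bar> + 1) / p0"]) (auto intro!: divide_nonneg_pos)
  qed
  then obtain k where k: "0 \<le> k" "(\<integral>x. ln (Y x) \<partial>M) - k * p0 < 0" by auto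
  define L where "L x = ln (Y x) - k * indicator {x \<in> space M. Y x = 0} x" for x
  have [measurable]: "L \<in> borel_measurable M" unfolding L_def by measurable
  have LC: "\<bar>L x\<bar> \<le> C + k" if "x \<in> space M" for x
    using C[OF that] k(1) by (auto simp: L_def indicator_def)
  have "(\<integral>x. L x \<partial>M) < 0"
  proof -
    have "integrable M (indicator {x \<in> space M. Y x = 0} :: 'a \<Rightarrow> real)"
      by (intro integrable_real_indicator) (auto simp: emeasure_eq_measure)
    then have "(\<integral>x. L x \<partial>M) = (\<integral>x. ln (Y x) \<partial>M) - k * p0"
      unfolding L_def using int by (simp add: p0_def Int_absorb2 subset_eq)
    then show ?thesis using k(2) by simp
  qed
  then obtain \<delta> where \<delta>: "0 < \<delta>" "(\<integral>x. exp (\<delta> * L x) \<partial>M) < 1"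
    using exp_moment_less_1[of L "C + k"] LC by auto
  \<comment> \<open>Equality where \<open>Y x\<close> is positive; on the zero set the left side is
    0, whatever the penalty.\<close>
  have le: "Y x powr \<delta> \<le> exp (\<delta> * L x)" if "x \<in> space M" for x
    by (auto simp: L_def powr_def indicator_def)
  have bnd: "exp (\<delta> * L x) \<le> exp (\<delta> * (C + k))" if "x \<in> space M" for x
    using LC[OF that] \<delta>(1) by (auto simp: abs_le_iff)
  have "(\<integral>x. Y x powr \<delta> \<partial>M) \<le> (\<integral>x. exp (\<delta> * L x) \<partial>M)"
  proof (intro integral_mono)
    show "integrable M (\<lambda>x. exp (\<delta> * L x))"
      using bnd by (intro integrable_const_bound[of _ "exp (\<delta> * (C + k))"]) auto
    show "integrable M (\<lambda>x. Y x powr \<delta>)"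
      using order_trans[OF le bnd] by (intro integrable_const_bound[of _ "exp (\<delta> * (C + k))"]) auto
  qed (use le in auto)
  then show thesis using that \<delta> by force
qed

section \<open>Products of random matrices taking finitely many values\<close>

context iid_process
begin

lemma space_N_nonempty: "space N \<noteq> {}"
  using measurable_space[OF X_measurable] not_empty by blast

text \<open>Padding with a constant turns a functional of whole paths into a function of the
  coordinates in \<open>I\<close> alone. Both the independence of functionals and nonanticipativity
  rest on this.\<close>

lemma measurable_extend:
  assumes "c \<in> space N"
  shows "(\<lambda>h u. if u \<in> I then h u else c) \<in> (\<Pi>\<^sub>M u\<in>I. N) \<rightarrow>\<^sub>M PS"
proof (rule measurable_PiM_single')
  show "(\<lambda>h. if u \<in> I then h u else c) \<in> (\<Pi>\<^sub>M u\<in>I. N) \<rightarrow>\<^sub>M N" for u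
    using assms by (cases "u \<in> I") auto
qed (use assms in \<open>auto simp: space_PiM PiE_iff\<close>)

lemma disjoint_coordinates_indep_integral:
  fixes f g :: "(int \<Rightarrow> 'b) \<Rightarrow> real"
  assumes f [measurable]: "f \<in> borel_measurable PS" and g [measurable]: "g \<in> borel_measurable PS"
    and fI: "\<And>h h'. (\<And>u. u \<in> I \<Longrightarrow> h u = h' u) \<Longrightarrow> f h = f h'"
    and gJ: "\<And>h h'. (\<And>u. u \<in> J \<Longrightarrow> h u = h' u) \<Longrightarrow> g h = g h'"
    and "I \<inter> J = {}"
    and "integrable M (\<lambda>x. f (path x))" "integrable M (\<lambda>x. g (path x))"
  shows "(\<integral>x. f (path x) * g (path x) \<partial>M) = (\<integral>x. f (path x) \<partial>M) * (\<integral>x. g (path x) \<partial>M)"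
proof -
  obtain c where c: "c \<in> space N" using space_N_nonempty by blast
  let ?ext = "\<lambda>I h u. if u \<in> I then h u else c"
  have "indep_var borel ((\<lambda>h. f (?ext I h)) \<circ> (\<lambda>x. restrict (path x) I))
      borel ((\<lambda>h. g (?ext J h)) \<circ> (\<lambda>x. restrict (path x) J))"
    using indep_var_restrict[OF indep \<open>I \<inter> J = {}\<close>] unfolding path_def
    by (rule indep_var_compose)
      (auto intro!: measurable_compose[OF measurable_extend[OF c] f] measurable_compose[OF measurable_extend[OF c] g])
  moreover have "(\<lambda>h. f (?ext I h)) \<circ> (\<lambda>x. restrict (path x) I) = (\<lambda>x. f (path x))"
    by (auto simp: fun_eq_iff intro!: fI)
  moreover have "(\<lambda>h. g (?ext J h)) \<circ> (\<lambda>x. restrict (path x) J) = (\<lambda>x. g (path x))"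
    by (auto simp: fun_eq_iff intro!: gJ)
  ultimately show ?thesis
    using assms(6,7) by (intro indep_var_lebesgue_integral) simp_all
qed

end

section \<open>Matrix entries under a submultiplicative norm\<close>

definition unit_matrix :: "nat \<Rightarrow> nat \<Rightarrow> nat \<Rightarrow> real mat" where
  "unit_matrix d i j = mat d d (\<lambda>(k, l). of_bool (k = i \<and> l = j))"

lemma unit_matrix_carrier [simp]: "unit_matrix d i j \<in> carrier_mat d d"
  by (simp add: unit_matrix_def)

lemma unit_matrix_sandwich:
  assumes A: "A \<in> carrier_mat d d" and ij: "i < d" "j < d"
  shows "unit_matrix d i i * A * unit_matrix d j j = A $$ (i, j) \<cdot>\<^sub>m unit_matrix d i j"
proof (rule eq_matI)
  fix k l assume kl: "k < dim_row (A $$ (i, j) \<cdot>\<^sub>m unit_matrix d i j)"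
    "l < dim_col (A $$ (i, j) \<cdot>\<^sub>m unit_matrix d i j)"
  then have kl: "k < d" "l < d" by (auto simp: unit_matrix_def)
  have 1: "(unit_matrix d i i * A) $$ (k, m) = of_bool (k = i) * A $$ (i, m)" if "m < d" for m
    using A ij kl that
    by (auto simp: unit_matrix_def scalar_prod_def if_distrib[of "\<lambda>x. x * _"] sum.If_cases cong: if_cong)
  have "(unit_matrix d i i * A * unit_matrix d j j) $$ (k, l) =
      (\<Sum>m = 0..<d. (unit_matrix d i i * A) $$ (k, m) * unit_matrix d j j $$ (m, l))"
    using A ij kl by (simp add: scalar_prod_def unit_matrix_def)
  also have "\<dots> = (\<Sum>m = 0..<d. if m = j then of_bool (k = i \<and> l = j) * A $$ (i, j) else 0)"
  proof (intro sum.cong refl)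
    fix m assume "m \<in> {0..<d}"
    then have m: "m < d" by simp
    show "(unit_matrix d i i * A) $$ (k, m) * unit_matrix d j j $$ (m, l) =
        (if m = j then of_bool (k = i \<and> l = j) * A $$ (i, j) else 0)"
      unfolding 1[OF m] using ij kl m by (auto simp: unit_matrix_def)
  qed
  also have "\<dots> = of_bool (k = i \<and> l = j) * A $$ (i, j)"
    using ij by (simp add: sum.delta)
  finally show "(unit_matrix d i i * A * unit_matrix d j j) $$ (k, l) =
      (A $$ (i, j) \<cdot>\<^sub>m unit_matrix d i j) $$ (k, l)"
    using kl by (simp add: unit_matrix_def)
qed (use A in \<open>auto simp: unit_matrix_def\<close>)

text \<open>Sandwiching \<open>A\<close> between two diagonal matrix units isolates one entry, so
  submultiplicativity and homogeneity give an explicit constant, without the equivalence of norms in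
  finite dimension.\<close>

lemma submultiplicative_norm_entry_bound:
  assumes "submultiplicative_norm d nrm"
  obtains K where "0 \<le> K"
    "\<And>A i j. A \<in> carrier_mat d d \<Longrightarrow> i < d \<Longrightarrow> j < d \<Longrightarrow> \<bar>A $$ (i, j)\<bar> \<le> K * nrm A"
proof -
  have nn: "0 \<le> nrm A" and zero: "nrm A = 0 \<longleftrightarrow> A = 0\<^sub>m d d" and scale: "nrm (c \<cdot>\<^sub>m A) = \<bar>c\<bar> * nrm A"
    if "A \<in> carrier_mat d d" for A c
    using assms that by (auto simp: submultiplicative_norm_def)
  have mult: "nrm (A * B) \<le> nrm A * nrm B" if "A \<in> carrier_mat d d" "B \<in> carrier_mat d d" for A B
    using assms that by (auto simp: submultiplicative_norm_def)
  let ?E = "unit_matrix d"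
  define f where "f i j = nrm (?E i i) * nrm (?E j j) / nrm (?E i j)" for i j
  define K where "K = (\<Sum>i<d. \<Sum>j<d. f i j)"
  have f0: "0 \<le> f i j" for i j by (simp add: f_def nn)
  have fK: "f i j \<le> K" if "i < d" "j < d" for i j
  proof -
    have "f i j \<le> (\<Sum>j<d. f i j)" using that f0 by (intro member_le_sum) auto
    also have "\<dots> \<le> K" unfolding K_def using that f0 by (intro member_le_sum sum_nonneg) auto
    finally show ?thesis .
  qed
  show thesis
  proof (rule that[of K])
    show "0 \<le> K" by (auto simp: K_def intro!: sum_nonneg f0)
    fix A :: "real mat" and i j assume A: "A \<in> carrier_mat d d" and ij: "i < d" "j < d"
    have "?E i j $$ (i, j) \<noteq> 0\<^sub>m d d $$ (i, j)" using ij by (simp add: unit_matrix_def)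
    then have "?E i j \<noteq> 0\<^sub>m d d" by metis
    then have pos: "0 < nrm (?E i j)" using nn[of "?E i j"] zero[of "?E i j"] by (simp add: less_le)
    have "\<bar>A $$ (i, j)\<bar> * nrm (?E i j) = nrm (?E i i * A * ?E j j)"
      using A ij by (simp add: unit_matrix_sandwich scale)
    also have "\<dots> \<le> nrm (?E i i * A) * nrm (?E j j)"
      by (intro mult mult_carrier_mat[OF unit_matrix_carrier A] unit_matrix_carrier)
    also have "\<dots> \<le> nrm (?E i i) * nrm A * nrm (?E j j)"
      using A by (intro mult_right_mono mult nn unit_matrix_carrier)
    finally have "\<bar>A $$ (i, j)\<bar> \<le> f i j * nrm A"
      using pos by (simp add: f_def field_simps)
    also have "\<dots> \<le> K * nrm A" using fK[OF ij] nn[OF A] by (rule mult_right_mono)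
    finally show "\<bar>A $$ (i, j)\<bar> \<le> K * nrm A" .
  qed
qed

text \<open>With a finite range the matrices can be measurable into the discrete space. Every real
  function of a product is then measurable, bounded and integrable, in particular any norm, its
  \<open>ln\<close> and its powers.\<close>

locale random_matrix_product = iid_process M N X
  for M :: "'a measure" and N :: "'b measure" and X :: "int \<Rightarrow> 'a \<Rightarrow> 'b" +
  fixes d :: nat and C :: "'b \<Rightarrow> real mat" and nrm :: "real mat \<Rightarrow> real"
  assumes C_measurable: "C \<in> N \<rightarrow>\<^sub>M count_space UNIV"
    and C_finite: "finite (range C)"
    and C_carrier [simp]: "C e \<in> carrier_mat d d"
    and nrm: "submultiplicative_norm d nrm"
begin

text \<open>The product of the \<open>n\<close> matrices at times
  \<open>t, t - 1, \<dots>, t - n + 1\<close>. It takes a path instead of a sample point, so that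
  the shift acts on it.\<close>

primrec bprod :: "nat \<Rightarrow> int \<Rightarrow> (int \<Rightarrow> 'b) \<Rightarrow> real mat" where
  "bprod 0 t h = 1\<^sub>m d"
| "bprod (Suc n) t h = C (h t) * bprod n (t - 1) h"

lemma bprod_carrier [simp]: "bprod n t h \<in> carrier_mat d d"
  by (induction n arbitrary: t) (auto intro: mult_carrier_mat[OF C_carrier])

lemma bprod_finite: "finite (range (bprod n t))"
proof (induction n arbitrary: t)
  case 0
  have "range (bprod 0 t) = {1\<^sub>m d}" by auto
  then show ?case by simp
next
  case (Suc n)
  have "range (bprod (Suc n) t) \<subseteq> (\<lambda>(A, B). A * B) ` (range C \<times> range (bprod n (t - 1)))"
    by auto
  then show ?case
    by (rule finite_subset) (intro finite_imageI finite_cartesian_product C_finite Suc)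
qed

text \<open>Splitting over the finitely many values of the first factor leaves multiplication by a
  fixed matrix, which is a map between discrete spaces.\<close>

lemma bprod_measurable: "bprod n t \<in> PS \<rightarrow>\<^sub>M count_space UNIV"
proof (induction n arbitrary: t)
  case 0
  have "bprod 0 t = (\<lambda>h. 1\<^sub>m d)" by auto
  then show ?case by simp
next
  case (Suc n)
  note [measurable] = C_measurable
  have 1: "(\<lambda>h. C (h t)) \<in> PS \<rightarrow>\<^sub>M count_space (range C)"
  proof (rule measurable_count_space_eq2[OF C_finite, THEN iffD2], intro conjI ballI)
    fix A
    have "(\<lambda>h. C (h t)) \<in> PS \<rightarrow>\<^sub>M count_space UNIV" by measurable
    then show "(\<lambda>h. C (h t)) -` {A} \<inter> space PS \<in> sets PS" by (rule measurable_sets) simp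
  qed auto
  have "(\<lambda>h. A * bprod n (t - 1) h) \<in> PS \<rightarrow>\<^sub>M count_space UNIV" for A
    by (rule measurable_compose[OF Suc]) simp
  then have "(\<lambda>h. C (h t) * bprod n (t - 1) h) \<in> PS \<rightarrow>\<^sub>M count_space UNIV"
    by (rule measurable_compose_countable'[OF _ 1]) (use C_finite in \<open>auto intro: countable_finite\<close>)
  moreover have "bprod (Suc n) t = (\<lambda>h. C (h t) * bprod n (t - 1) h)" by auto
  ultimately show ?case by simp
qed

lemma bprod_borel_measurable [measurable]:
  fixes F :: "real mat \<Rightarrow> real"
  shows "(\<lambda>h. F (bprod n t h)) \<in> borel_measurable PS"
  by (rule measurable_compose[OF bprod_measurable]) simp

lemma bprod_bounded:
  fixes F :: "real mat \<Rightarrow> real"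
  shows "\<exists>B. \<forall>h. \<bar>F (bprod n t h)\<bar> \<le> B"
proof -
  have "finite ((\<lambda>A. \<bar>F A\<bar>) ` range (bprod n t))" using bprod_finite by blast
  then have "\<bar>F (bprod n t h)\<bar> \<le> Max ((\<lambda>A. \<bar>F A\<bar>) ` range (bprod n t))" for h
    by (intro Max_ge) auto
  then show ?thesis by blast
qed

lemma bprod_integrable [simp]:
  fixes F :: "real mat \<Rightarrow> real"
  shows "integrable M (\<lambda>x. F (bprod n t (path x)))"
proof -
  obtain B where "\<And>h. \<bar>F (bprod n t h)\<bar> \<le> B"
    using bprod_bounded[of F n t] by blast
  then show ?thesis by (intro integrable_const_bound[of _ B]) auto
qed

lemma bprod_shift: "bprod n (t + k) h = bprod n t (shift k h)"
proof (induction n arbitrary: t)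
  case (Suc n)
  have "t + k - 1 = t - 1 + k" by simp
  then show ?case
    using Suc[of "t - 1"] by (simp only: bprod.simps shift_def)
qed simp

lemma bprod_cong:
  "(\<And>u. t - int n < u \<Longrightarrow> u \<le> t \<Longrightarrow> h u = h' u) \<Longrightarrow> bprod n t h = bprod n t h'"
proof (induction n arbitrary: t)
  case (Suc n)
  have "bprod n (t - 1) h = bprod n (t - 1) h'"
    by (rule Suc.IH) (rule Suc.prems, auto)
  then show ?case using Suc.prems[of t] by simp
qed simp

lemma bprod_add: "bprod (m + n) t h = bprod m t h * bprod n (t - int m) h"
proof (induction m arbitrary: t)
  case 0
  show ?case by (simp add: left_mult_one_mat[OF bprod_carrier])
next
  case (Suc m)
  show ?case
    by (simp add: Suc assoc_mult_mat[OF C_carrier bprod_carrier bprod_carrier] algebra_simps)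
qed

lemma back_prod_eq: "back_prod d (\<lambda>s. C (X s x)) n = bprod n (int n) (path x)"
proof (induction n)
  case (Suc n)
  have "int (Suc n) - 1 = int n" by simp
  then show ?case using Suc by (simp only: back_prod.simps bprod.simps path_def)
qed simp

lemma nrm_nonneg: "A \<in> carrier_mat d d \<Longrightarrow> 0 \<le> nrm A"
  and nrm_mult: "A \<in> carrier_mat d d \<Longrightarrow> B \<in> carrier_mat d d \<Longrightarrow> nrm (A * B) \<le> nrm A * nrm B"
  using nrm by (auto simp: submultiplicative_norm_def)

lemma nrm_bprod_nonneg [simp]: "0 \<le> nrm (bprod n t h)"
  by (simp add: nrm_nonneg)

lemma nrm_bprod_add: "nrm (bprod (m + n) t h) \<le> nrm (bprod m t h) * nrm (bprod n (t - int m) h)"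
  by (simp add: bprod_add nrm_mult)

lemma bprod_integral_shift:
  fixes F :: "real mat \<Rightarrow> real"
  shows "(\<integral>x. F (bprod n t (path x)) \<partial>M) = (\<integral>x. F (bprod n s (path x)) \<partial>M)"
proof -
  have "bprod n t h = bprod n s (shift (t - s) h)" for h
    using bprod_shift[of n s "t - s" h] by simp
  then show ?thesis
    using shift_invariant_integral[of "\<lambda>h. F (bprod n s h)" "t - s"] by simp
qed

text \<open>The two products read adjacent, disjoint time windows.\<close>

lemma bprod_integral_mult:
  fixes F F' :: "real mat \<Rightarrow> real"
  shows "(\<integral>x. F (bprod m t (path x)) * F' (bprod n (t - int m) (path x)) \<partial>M) =
    (\<integral>x. F (bprod m t (path x)) \<partial>M) * (\<integral>x. F' (bprod n (t - int m) (path x)) \<partial>M)"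
proof (rule disjoint_coordinates_indep_integral[where I="{t - int m<..t}" and J="{t - int m - int n<..t - int m}"])
  show "F (bprod m t h) = F (bprod m t h')" if "\<And>u. u \<in> {t - int m<..t} \<Longrightarrow> h u = h' u" for h h'
    using that by (intro arg_cong[where f=F] bprod_cong) auto
  show "F' (bprod n (t - int m) h) = F' (bprod n (t - int m) h')"
    if "\<And>u. u \<in> {t - int m - int n<..t - int m} \<Longrightarrow> h u = h' u" for h h'
    using that by (intro arg_cong[where f=F'] bprod_cong) auto
qed auto

section \<open>From a negative exponent to exponential decay\<close>

definition log_norm :: "nat \<Rightarrow> 'a \<Rightarrow> ereal" where
  "log_norm n x = elog (ereal (nrm (bprod n (int n) (path x))))"

lemma top_lyapunov_eq:
  "top_lyapunov M d nrm (\<lambda>t x. C (X t x)) =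
    lim (\<lambda>n. ext_expectation M (log_norm n) / ereal (real n))"
  by (simp add: top_lyapunov_def back_prod_eq log_norm_def[abs_def])

text \<open>If all the expectations were nonnegative, Fekete's lemma would make the limit exist and be
  nonnegative; for a divergent sequence \<^const>\<open>lim\<close> is unspecified.\<close>

lemma exists_negative_log_expectation:
  assumes "top_lyapunov M d nrm (\<lambda>t x. C (X t x)) < 0"
  obtains T where "1 \<le> T" "ext_expectation M (log_norm T) < 0"
proof (rule ccontr)
  assume "\<not> thesis"
  then have nonneg: "0 \<le> ext_expectation M (log_norm n)" if "1 \<le> n" for n
    using that \<open>\<And>T. 1 \<le> T \<Longrightarrow> ext_expectation M (log_norm T) < 0 \<Longrightarrow> thesis\<close> not_le by blast
  define Y where "Y n t x = nrm (bprod n t (path x))" for n t x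
  define u where "u n = (\<integral>x. ln (Y n (int n) x) \<partial>M)" for n
  have int: "integrable M (\<lambda>x. ln (Y n t x))" for n t
    unfolding Y_def by (rule bprod_integrable)
  have [measurable]: "(\<lambda>x. Y n t x) \<in> borel_measurable M" for n t
    unfolding Y_def by measurable
  have Y0: "0 \<le> Y n t x" for n t x by (simp add: Y_def)
  have ln_eq: "log_norm n = (\<lambda>x. elog (ereal (Y n (int n) x)))" for n
    by (simp add: log_norm_def[abs_def] Y_def)
  \<comment> \<open>A product vanishing with positive probability would have expectation minus
    infinity, against the assumed nonnegativity.\<close>
  have pos: "AE x in M. 0 < Y n (int n) x" if "1 \<le> n" for n
    using ext_expectation_elog_eq_MInfty[OF int[of n "int n"]] Y0 nonneg[OF that] by (force simp: ln_eq)
  have eq: "ext_expectation M (log_norm n) = ereal (u n)" if "1 \<le> n" for n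
    unfolding ln_eq u_def by (rule ext_expectation_elog_eq_ln[OF int pos[OF that]])
  have sub: "u (m + n) \<le> u m + u n" if mn: "1 \<le> m" "1 \<le> n" for m n
  proof -
    have "AE x in M. 0 < Y (m + n) (int (m + n)) x" using mn by (intro pos) simp
    then have "AE x in M. ln (Y (m + n) (int (m + n)) x) \<le> ln (Y m (int (m + n)) x) + ln (Y n (int n) x)"
    proof eventually_elim
      case (elim x)
      have le: "Y (m + n) (int (m + n)) x \<le> Y m (int (m + n)) x * Y n (int n) x"
        using nrm_bprod_add[of m n "int (m + n)" "path x"] by (simp add: Y_def)
      then have prod: "0 < Y m (int (m + n)) x * Y n (int n) x" using elim by linarith
      then have "0 < Y m (int (m + n)) x" "0 < Y n (int n) x"
        using Y0[of m "int (m + n)" x] Y0[of n "int n" x] by (auto simp: zero_less_mult_iff)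
      then have "ln (Y m (int (m + n)) x * Y n (int n) x) = ln (Y m (int (m + n)) x) + ln (Y n (int n) x)"
        by (simp add: ln_mult)
      moreover have "ln (Y (m + n) (int (m + n)) x) \<le> ln (Y m (int (m + n)) x * Y n (int n) x)"
        using le by (subst ln_le_cancel_iff[OF elim prod])
      ultimately show ?case by linarith
    qed
    then have "u (m + n) \<le> (\<integral>x. ln (Y m (int (m + n)) x) + ln (Y n (int n) x) \<partial>M)"
      unfolding u_def using int by (intro integral_mono_AE) auto
    also have "\<dots> = (\<integral>x. ln (Y m (int (m + n)) x) \<partial>M) + u n"
      using int by (simp add: u_def)
    also have "(\<integral>x. ln (Y m (int (m + n)) x) \<partial>M) = u m"
      unfolding u_def Y_def by (rule bprod_integral_shift)
    finally show ?thesis .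
  qed
  have u0: "0 \<le> u n" if "1 \<le> n" for n
    using nonneg[OF that] eq[OF that] by simp
  obtain L where L: "0 \<le> L" "(\<lambda>n. u n / real n) \<longlonglongrightarrow> L"
    using fekete_nonneg[of u] sub u0 by blast
  have "(\<lambda>n. ext_expectation M (log_norm n) / ereal (real n)) \<longlonglongrightarrow> ereal L"
  proof (rule Lim_transform_eventually)
    show "(\<lambda>n. ereal (u n / real n)) \<longlonglongrightarrow> ereal L" using L(2) by simp
    show "\<forall>\<^sub>F n in sequentially. ereal (u n / real n) = ext_expectation M (log_norm n) / ereal (real n)"
      using eventually_ge_at_top[of 1] by eventually_elim (simp add: eq)
  qed
  then have "top_lyapunov M d nrm (\<lambda>t x. C (X t x)) = ereal L"
    unfolding top_lyapunov_eq by (rule limI)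
  then show False using assms L(1) by simp
qed

text \<open>Independence of adjacent blocks makes the moments \<open>e n\<close> submultiplicative.
  One value \<open>e T\<close> below 1 therefore forces geometric decay.\<close>

lemma norm_moment_decay:
  assumes "top_lyapunov M d nrm (\<lambda>t x. C (X t x)) < 0"
  obtains \<delta> r K where "0 < \<delta>" "0 < r" "r < 1" "0 \<le> K"
    "\<And>n t. (\<integral>x. nrm (bprod n t (path x)) powr \<delta> \<partial>M) \<le> K * r ^ n"
proof -
  obtain T where T: "1 \<le> T" "ext_expectation M (log_norm T) < 0"
    using exists_negative_log_expectation[OF assms] by blast
  obtain B where B: "\<And>h. \<bar>ln (nrm (bprod T (int T) h))\<bar> \<le> B"
    using bprod_bounded[of "\<lambda>A. ln (nrm A)" T "int T"] by blast
  obtain \<delta> where \<delta>: "0 < \<delta>" "(\<integral>x. nrm (bprod T (int T) (path x)) powr \<delta> \<partial>M) < 1"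
    by (rule powr_moment_less_1[of "\<lambda>x. nrm (bprod T (int T) (path x))" B])
      (use B T(2) in \<open>auto simp: log_norm_def[abs_def]\<close>)
  define e where "e n = (\<integral>x. nrm (bprod n 0 (path x)) powr \<delta> \<partial>M)" for n
  have e: "(\<integral>x. nrm (bprod n t (path x)) powr \<delta> \<partial>M) = e n" for n t
    unfolding e_def by (rule bprod_integral_shift)
  have e0: "0 \<le> e n" for n by (simp add: e_def)
  have int: "integrable M (\<lambda>x. nrm (bprod n t (path x)) powr \<delta>)" for n t
    by (rule bprod_integrable)
  have sub: "e (m + n) \<le> e m * e n" for m n
  proof -
    have "e (m + n) \<le> (\<integral>x. nrm (bprod m 0 (path x)) powr \<delta> * nrm (bprod n (0 - int m) (path x)) powr \<delta> \<partial>M)"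
      unfolding e_def
    proof (rule integral_mono)
      show "integrable M (\<lambda>x. nrm (bprod m 0 (path x)) powr \<delta> * nrm (bprod n (0 - int m) (path x)) powr \<delta>)"
      proof -
        obtain B1 where B1: "\<And>h. \<bar>nrm (bprod m 0 h) powr \<delta>\<bar> \<le> B1"
    using bprod_bounded[of "\<lambda>A. nrm A powr \<delta>" m 0] by blast
        obtain B2 where B2: "\<And>h. \<bar>nrm (bprod n (0 - int m) h) powr \<delta>\<bar> \<le> B2"
    using bprod_bounded[of "\<lambda>A. nrm A powr \<delta>" n "0 - int m"] by blast
        have "0 \<le> B1" by (rule order_trans[OF abs_ge_zero B1])
        then have "norm (nrm (bprod m 0 h) powr \<delta> * nrm (bprod n (0 - int m) h) powr \<delta>) \<le> B1 * B2" for h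
          using B1[of h] B2[of h] unfolding real_norm_def abs_mult by (intro mult_mono) auto
        then show ?thesis by (intro integrable_const_bound[of _ "B1 * B2"]) auto
      qed
      show "nrm (bprod (m + n) 0 (path x)) powr \<delta> \<le>
          nrm (bprod m 0 (path x)) powr \<delta> * nrm (bprod n (0 - int m) (path x)) powr \<delta>" for x
        using powr_mono2[OF _ _ nrm_bprod_add[of m n 0 "path x"], of \<delta>] \<delta>(1)
        by (simp add: powr_mult)
    qed (rule int)
    also have "\<dots> = e m * e n"
      unfolding bprod_integral_mult[of "\<lambda>A. nrm A powr \<delta>" m 0 "\<lambda>A. nrm A powr \<delta>" n] e ..
    finally show ?thesis .
  qed
  \<comment> \<open>The lower bound 1/2 keeps \<open>r0\<close> positive even if
    \<open>e T = 0\<close>; division by \<open>r0\<close> and real powers of it follow.\<close>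
  define r0 where "r0 = max (e T) (1/2)"
  have r0: "0 < r0" "r0 < 1" "e T \<le> r0" using \<delta>(2) e by (auto simp: r0_def)
  define r where "r = r0 powr (1 / real T)"
  have r: "0 < r" "r < 1"
    using r0 T(1) powr_less_mono2[of "1 / real T" r0 1] by (auto simp: r_def)
  define K0 where "K0 = (\<Sum>j<T. e j)"
  have K0: "0 \<le> K0" "\<And>j. j < T \<Longrightarrow> e j \<le> K0"
    by (auto simp: K0_def e0 intro!: sum_nonneg member_le_sum)
  have blocks: "e (k * T + j) \<le> r0 ^ k * K0" if "j < T" for k j
  proof (induction k)
    case 0
    then show ?case using K0(2)[OF that] by simp
  next
    case (Suc k)
    have "e (T + (k * T + j)) \<le> e T * e (k * T + j)" by (rule sub)
    also have "\<dots> \<le> r0 * (r0 ^ k * K0)"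
      using r0 Suc e0 by (intro mult_mono) auto
    finally show ?case by (simp add: algebra_simps)
  qed
  have "e n \<le> (K0 / r0) * r ^ n" for n
  proof -
    have T0: "0 < real T" using T(1) by simp
    have "e n \<le> r0 ^ (n div T) * K0"
      using blocks[of "n mod T" "n div T"] T(1) by simp
    also have "r0 ^ (n div T) = r0 powr real (n div T)"
      using r0 by (simp add: powr_realpow)
    \<comment> \<open>Rounding down to whole blocks loses at most 1 in the exponent; this is the
      factor \<open>1 / r0\<close> in the final constant, while \<open>K0\<close> covers the
      incomplete block.\<close>
    also have "\<dots> \<le> r0 powr (real n / real T - 1)"
    proof (rule powr_mono')
      have "real n = real (n div T) * real T + real (n mod T)"
        by (simp flip: of_nat_mult of_nat_add)
      moreover have "real (n mod T) \<le> real T" using T(1) by simp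
      ultimately show "real n / real T - 1 \<le> real (n div T)"
        using T0 by (simp add: field_simps)
    qed (use r0 in auto)
    also have "\<dots> = r ^ n / r0"
    proof -
      have "r ^ n = r powr real n" using r by (simp add: powr_realpow)
      also have "\<dots> = r0 powr (real n / real T)"
        by (simp add: r_def powr_powr)
      finally show ?thesis using r0 by (simp add: powr_diff)
    qed
    finally show ?thesis using K0(1) by (simp add: mult_right_mono field_simps)
  qed
  then show thesis
    using that[of \<delta> r "K0 / r0"] \<delta>(1) r K0(1) r0(1) e by simp
qed

text \<open>The conclusion stays a statement about summable probabilities because it serves twice:
  through Borel-Cantelli for the convergence of the series, and as convergence in probability for
  uniqueness.\<close>

lemma norm_exponential_decay:
  assumes "top_lyapunov M d nrm (\<lambda>t x. C (X t x)) < 0"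
  obtains \<rho> where "0 < \<rho>" "\<rho> < 1"
    "\<And>t. summable (\<lambda>n. prob {x \<in> space M. \<rho> ^ n < nrm (bprod n t (path x))})"
proof -
  obtain \<delta> r K where *: "0 < \<delta>" "0 < r" "r < 1" "0 \<le> K"
    and mom: "\<And>n t. (\<integral>x. nrm (bprod n t (path x)) powr \<delta> \<partial>M) \<le> K * r ^ n"
    using norm_moment_decay[OF assms] by blast
  \<comment> \<open>Chosen so that the threshold satisfies
    \<open>\<rho> powr \<delta> = sqrt r\<close>: Markov's inequality consumes half of the decay
    rate and leaves the other half.\<close>
  define \<rho> where "\<rho> = r powr (1 / (2 * \<delta>))"
  have \<rho>: "0 < \<rho>" "\<rho> < 1"
    using * powr_less_mono2[of "1 / (2 * \<delta>)" r 1] by (auto simp: \<rho>_def)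
  have \<rho>n: "(\<rho> ^ n) powr \<delta> = sqrt r ^ n" for n
  proof -
    have "(\<rho> ^ n) powr \<delta> = (\<rho> powr \<delta>) ^ n"
      using \<rho> by (simp add: powr_powr mult.commute flip: powr_realpow)
    also have "\<rho> powr \<delta> = sqrt r"
      using * by (simp add: \<rho>_def powr_powr powr_half_sqrt)
    finally show ?thesis .
  qed
  have "summable (\<lambda>n. prob {x \<in> space M. \<rho> ^ n < nrm (bprod n t (path x))})" for t
  proof (rule summable_comparison_test')
    show "summable (\<lambda>n. K * sqrt r ^ n)"
      using * by (intro summable_mult summable_geometric) simp
    fix n
    have "prob {x \<in> space M. \<rho> ^ n < nrm (bprod n t (path x))}
        \<le> prob {x \<in> space M. sqrt r ^ n \<le> nrm (bprod n t (path x)) powr \<delta>}"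
    proof (rule finite_measure_mono)
      show "{x \<in> space M. \<rho> ^ n < nrm (bprod n t (path x))}
          \<subseteq> {x \<in> space M. sqrt r ^ n \<le> nrm (bprod n t (path x)) powr \<delta>}"
        using \<rho> * by (auto simp flip: \<rho>n intro!: powr_mono2)
    qed measurable
    also have "\<dots> \<le> (\<integral>x. nrm (bprod n t (path x)) powr \<delta> \<partial>M) / sqrt r ^ n"
      using * by (intro integral_Markov_inequality_measure[where A="{}"] bprod_integrable) auto
    also have "\<dots> \<le> K * r ^ n / sqrt r ^ n"
      using mom * by (intro divide_right_mono) auto
    also have "\<dots> = K * sqrt r ^ n"
    proof -
      have "r ^ n = sqrt r ^ n * sqrt r ^ n" using * by (simp flip: power_mult_distrib)
      then show ?thesis using * by simp
    qed
    finally show "norm (prob {x \<in> space M. \<rho> ^ n < nrm (bprod n t (path x))}) \<le> K * sqrt r ^ n"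
      by simp
  qed
  then show thesis using that \<rho> by blast
qed

end

section \<open>Markovian representation of the log-GARCH equation\<close>

lemma sum_lessThan_add:
  fixes f :: "nat \<Rightarrow> 'a :: comm_monoid_add"
  shows "(\<Sum>j<a + b. f j) = (\<Sum>j<a. f j) + (\<Sum>j<b. f (a + j))"
  by (induction b) (simp_all add: add.assoc)

text \<open>\<open>state_vec q E S t\<close> collects \<open>1{E > 0} log E\<^sup>2\<close> and \<open>1{E < 0} log E\<^sup>2\<close> at the times
  \<open>t, \<dots>, t - q + 1\<close> and \<open>log S\<^sup>2\<close> at \<open>t, \<dots>, t - p + 1\<close>. For a solution it satisfies the affine
  recursion with matrix \<open>C\<^sub>t\<close> and the inhomogeneity \<open>input_vec\<close>.\<close>

definition state_vec :: "nat \<Rightarrow> (int \<Rightarrow> real) \<Rightarrow> (int \<Rightarrow> real) \<Rightarrow> int \<Rightarrow> nat \<Rightarrow> real" where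
  "state_vec q E S t i =
     (if i < q then of_bool (E (t - int i) > 0) * ln ((E (t - int i))\<^sup>2)
      else if i < 2 * q then of_bool (E (t - int (i - q)) < 0) * ln ((E (t - int (i - q)))\<^sup>2)
      else ln ((S (t - int (i - 2 * q)))\<^sup>2))"

definition input_vec :: "nat \<Rightarrow> real \<Rightarrow> real \<Rightarrow> nat \<Rightarrow> real" where
  "input_vec q \<omega> e i =
     (if i < q \<and> i = 0 then of_bool (e > 0) * (\<omega> + ln (e\<^sup>2))
      else if i < 2 * q \<and> i = q then of_bool (e < 0) * (\<omega> + ln (e\<^sup>2))
      else if i = 2 * q then \<omega> else 0)"

lemma abs_input_vec_le: "\<bar>input_vec q \<omega> e i\<bar> \<le> \<bar>\<omega>\<bar> + \<bar>ln (e\<^sup>2)\<bar>"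
  by (auto simp: input_vec_def)

lemma input_vec_measurable [measurable]: "(\<lambda>e. input_vec q \<omega> e i) \<in> borel_measurable borel"
  unfolding input_vec_def by measurable

text \<open>Within a block, position j of the state at time t - 1 refers to time t - (j + 1), which
  matches entries counted from 0 with lags counted from 1.\<close>

lemma coeff_row_state_vec:
  "(\<Sum>j<2 * q + p. coeff_row q \<alpha>p \<alpha>m \<beta> j * state_vec q E S (t - 1) j) =
    (\<Sum>i = 1..q. (\<alpha>p i * of_bool (E (t - int i) > 0) + \<alpha>m i * of_bool (E (t - int i) < 0))
      * ln ((E (t - int i))\<^sup>2))
    + (\<Sum>j = 1..p. \<beta> j * ln ((S (t - int j))\<^sup>2))"
proof -
  let ?f = "\<lambda>j. coeff_row q \<alpha>p \<alpha>m \<beta> j * state_vec q E S (t - 1) j"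
  have "(\<Sum>j<2 * q + p. ?f j) = (\<Sum>j<q. ?f j) + (\<Sum>j<q. ?f (q + j)) + (\<Sum>j<p. ?f (q + q + j))"
    by (simp add: sum_lessThan_add mult_2)
  also have "(\<Sum>j<q. ?f j) = (\<Sum>j<q. \<alpha>p (Suc j) * of_bool (E (t - int (Suc j)) > 0) * ln ((E (t - int (Suc j)))\<^sup>2))"
    by (intro sum.cong) (auto simp: coeff_row_def state_vec_def algebra_simps)
  also have "(\<Sum>j<q. ?f (q + j)) = (\<Sum>j<q. \<alpha>m (Suc j) * of_bool (E (t - int (Suc j)) < 0) * ln ((E (t - int (Suc j)))\<^sup>2))"
    by (intro sum.cong) (auto simp: coeff_row_def state_vec_def algebra_simps)
  also have "(\<Sum>j<p. ?f (q + q + j)) = (\<Sum>j<p. \<beta> (Suc j) * ln ((S (t - int (Suc j)))\<^sup>2))"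
    by (intro sum.cong) (auto simp: coeff_row_def state_vec_def algebra_simps mult_2)
  finally show ?thesis
    by (simp only: One_nat_def sum.atLeast1_atMost_eq sum.distrib[symmetric] distrib_right)
qed

lemma garch_matrix_row:
  assumes "i < 2 * q + p"
  shows "(\<Sum>j<2 * q + p. garch_matrix p q \<alpha>p \<alpha>m \<beta> e $$ (i, j) * v j) =
    (if i < q \<and> i = 0 then of_bool (e > 0) * (\<Sum>j<2 * q + p. coeff_row q \<alpha>p \<alpha>m \<beta> j * v j)
     else if i < 2 * q \<and> i = q then of_bool (e < 0) * (\<Sum>j<2 * q + p. coeff_row q \<alpha>p \<alpha>m \<beta> j * v j)
     else if i = 2 * q then (\<Sum>j<2 * q + p. coeff_row q \<alpha>p \<alpha>m \<beta> j * v j)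
     else v (i - 1))"
proof (cases "i < q \<and> i = 0 \<or> i < 2 * q \<and> i = q \<or> i = 2 * q")
  case True
  then show ?thesis
    using assms by (auto simp: garch_matrix_def sum_distrib_left mult.assoc intro!: sum.cong)
next
  case False
  then have i: "1 \<le> i" by (cases i) auto
  have "(\<Sum>j<2 * q + p. garch_matrix p q \<alpha>p \<alpha>m \<beta> e $$ (i, j) * v j)
      = (\<Sum>j<2 * q + p. if j = i - 1 then v j else 0)"
    using assms False i by (intro sum.cong) (auto simp: garch_matrix_def)
  also have "\<dots> = v (i - 1)" using assms i by (simp add: sum.delta)
  finally show ?thesis using False by auto
qed

text \<open>Away from the heads of the three blocks, moving one position down and one step forward
  in time reads the same observation.\<close>

lemma state_vec_shift:
  assumes "\<not> (Suc i < 2 * q \<and> Suc i = q)" "Suc i \<noteq> 2 * q"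
  shows "state_vec q E S t (Suc i) = state_vec q E S (t - 1) i"
proof -
  consider "Suc i < q" | "q \<le> i" "Suc i < 2 * q" | "2 * q \<le> i"
    using assms by linarith
  then show ?thesis
  proof cases
    case 1
    have "t - int (Suc i) = t - 1 - int i" by simp
    then show ?thesis using 1 by (simp only: state_vec_def) simp
  next
    case 2
    then have "t - int (Suc i - q) = t - 1 - int (i - q)" by simp
    then show ?thesis using 2 by (simp only: state_vec_def) simp
  next
    case 3
    then have "t - int (Suc i - 2 * q) = t - 1 - int (i - 2 * q)" by simp
    then show ?thesis using 3 by (simp only: state_vec_def) simp
  qed
qed

text \<open>Since \<open>S t\<close> is positive, the indicators of the sign of \<open>E t\<close>
  can be read off \<open>e\<close>, and \<open>ln ((E t)\<^sup>2)\<close> splits into the volatility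
  part and \<open>ln (e\<^sup>2)\<close>. This makes the random matrix a function of the innovation
  alone.\<close>

lemma state_vec_recursion:
  assumes S: "S t > 0" and E: "E t = S t * e" and e: "e \<noteq> 0"
    and eq: "ln ((S t)\<^sup>2) = \<omega> + (\<Sum>j<2 * q + p. coeff_row q \<alpha>p \<alpha>m \<beta> j * state_vec q E S (t - 1) j)"
    and i: "i < 2 * q + p"
  shows "state_vec q E S t i =
    (\<Sum>j<2 * q + p. garch_matrix p q \<alpha>p \<alpha>m \<beta> e $$ (i, j) * state_vec q E S (t - 1) j) + input_vec q \<omega> e i"
proof -
  let ?s = "\<Sum>j<2 * q + p. coeff_row q \<alpha>p \<alpha>m \<beta> j * state_vec q E S (t - 1) j"
  have sgn: "E t > 0 \<longleftrightarrow> e > 0" "E t < 0 \<longleftrightarrow> e < 0"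
    using S by (auto simp: E zero_less_mult_iff mult_less_0_iff)
  have lnE: "ln ((E t)\<^sup>2) = ?s + (\<omega> + ln (e\<^sup>2))"
    using S e eq by (simp add: E power_mult_distrib ln_mult)
  consider "i < q" "i = 0" | "i < 2 * q" "i = q" | "i = 2 * q"
    | "\<not> (i < q \<and> i = 0)" "\<not> (i < 2 * q \<and> i = q)" "i \<noteq> 2 * q" by blast
  then show ?thesis
  proof cases
    case 1
    then show ?thesis
      unfolding garch_matrix_row[OF i]
      by (simp add: state_vec_def[of _ _ _ t] input_vec_def sgn lnE distrib_left)
  next
    case 2
    then show ?thesis
      unfolding garch_matrix_row[OF i]
      by (simp add: state_vec_def[of _ _ _ t] input_vec_def sgn lnE distrib_left)
  next
    case 3
    then show ?thesis
      unfolding garch_matrix_row[OF i]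
      by (simp add: state_vec_def[of _ _ _ t] input_vec_def eq)
  next
    case 4
    then obtain k where "i = Suc k" by (cases i) auto
    then have "state_vec q E S t i = state_vec q E S (t - 1) (i - 1)"
      using 4 by (simp add: state_vec_shift)
    then show ?thesis
      unfolding garch_matrix_row[OF i] using 4 by (auto simp: input_vec_def)
  qed
qed

text \<open>The converse direction, used for existence: a solution of the vector recursion really
  consists of lagged values of one process. Block heads come from the defining equations, the other
  entries by induction along the shift rows.\<close>

lemma state_vec_eqI:
  assumes rec: "\<And>t i. i < 2 * q + p \<Longrightarrow>
      z t i = (\<Sum>j<2 * q + p. garch_matrix p q \<alpha>p \<alpha>m \<beta> (e t) $$ (i, j) * z (t - 1) j) + input_vec q \<omega> (e t) i"
    and S: "\<And>t. S t > 0" and E: "\<And>t. E t = S t * e t" and e: "\<And>t. e t \<noteq> 0"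
    and lnS: "\<And>t. ln ((S t)\<^sup>2) = \<omega> + (\<Sum>j<2 * q + p. coeff_row q \<alpha>p \<alpha>m \<beta> j * z (t - 1) j)"
  shows "i < 2 * q + p \<Longrightarrow> state_vec q E S t i = z t i"
proof (induction i arbitrary: t)
  have sgn: "E t > 0 \<longleftrightarrow> e t > 0" "E t < 0 \<longleftrightarrow> e t < 0" for t
    using S[of t] by (auto simp: E zero_less_mult_iff mult_less_0_iff)
  have lnE: "ln ((E t)\<^sup>2) = (\<Sum>j<2 * q + p. coeff_row q \<alpha>p \<alpha>m \<beta> j * z (t - 1) j) + (\<omega> + ln ((e t)\<^sup>2))" for t
    using S[of t] e[of t] lnS[of t] by (simp add: E power_mult_distrib ln_mult)
  have head: "state_vec q E S t k = z t k"
    if k: "k < 2 * q + p" "k < q \<and> k = 0 \<or> k < 2 * q \<and> k = q \<or> k = 2 * q" for t k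
    unfolding rec[OF k(1)] garch_matrix_row[OF k(1)] using k
    by (auto simp: state_vec_def input_vec_def sgn lnE lnS distrib_left)
  {
    case 0
    then show ?case by (intro head) auto
  next
    case (Suc i)
    show ?case
    proof (cases "Suc i < 2 * q \<and> Suc i = q \<or> Suc i = 2 * q")
      case True
      then show ?thesis using Suc.prems by (intro head) auto
    next
      case False
      have "state_vec q E S t (Suc i) = state_vec q E S (t - 1) i"
        using False by (intro state_vec_shift) auto
      also have "\<dots> = z (t - 1) i" using Suc by simp
      finally show ?thesis
        unfolding rec[OF Suc.prems] garch_matrix_row[OF Suc.prems]
        using False by (auto simp: input_vec_def)
    qed
  }
qed

text \<open>Time is countable, so the exceptional null sets of all equations merge into one.\<close>

lemma log_garch_equations_iff:
  "log_garch_equations M \<eta> p q \<omega> \<alpha>p \<alpha>m \<beta> \<epsilon> \<sigma> \<longleftrightarrow>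
    (AE x in M. \<forall>t. \<sigma> t x > 0 \<and> \<epsilon> t x = \<sigma> t x * \<eta> t x \<and>
      ln ((\<sigma> t x)\<^sup>2) = \<omega> + (\<Sum>j<2 * q + p. coeff_row q \<alpha>p \<alpha>m \<beta> j *
        state_vec q (\<lambda>t. \<epsilon> t x) (\<lambda>t. \<sigma> t x) (t - 1) j))"
  unfolding log_garch_equations_def coeff_row_state_vec AE_all_countable by (simp add: add.assoc)

text \<open>The matrix depends on the innovation only through its sign, so it has at most three
  values.\<close>

lemma garch_matrix_measurable: "garch_matrix p q \<alpha>p \<alpha>m \<beta> \<in> borel \<rightarrow>\<^sub>M count_space UNIV"
  and garch_matrix_finite_range: "finite (range (garch_matrix p q \<alpha>p \<alpha>m \<beta>))"
proof -
  let ?C = "garch_matrix p q \<alpha>p \<alpha>m \<beta>"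
  have eq: "?C = (\<lambda>e. if e > 0 then ?C 1 else if e < 0 then ?C (-1) else ?C 0)"
    by (auto simp: fun_eq_iff garch_matrix_def intro!: cong_mat)
  show "?C \<in> borel \<rightarrow>\<^sub>M count_space UNIV" by (subst eq) measurable
  have "range ?C \<subseteq> {?C 1, ?C (-1), ?C 0}" by (subst eq) auto
  then show "finite (range ?C)" by (rule finite_subset) simp
qed

section \<open>Tightness\<close>

lemma strictly_stationary_distr:
  assumes "strictly_stationary M N X"
  shows "distr M N (X t) = distr M N (X 0)"
proof -
  have [measurable]: "X t \<in> M \<rightarrow>\<^sub>M N" for t
    using assms by (simp add: strictly_stationary_def)
  have eq: "distr M (\<Pi>\<^sub>M s\<in>{0::int}. N) (\<lambda>x. \<lambda>s\<in>{0}. X (s + t) x) = distr M (\<Pi>\<^sub>M s\<in>{0}. N) (\<lambda>x. \<lambda>s\<in>{0}. X s x)"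
    using assms by (simp add: strictly_stationary_def)
  have [measurable]: "(\<lambda>x. \<lambda>s\<in>{0}. X (s + u) x) \<in> M \<rightarrow>\<^sub>M (\<Pi>\<^sub>M s\<in>{0::int}. N)" for u
    by (intro measurable_restrict) simp
  have [measurable]: "(\<lambda>f. f 0) \<in> (\<Pi>\<^sub>M s\<in>{0::int}. N) \<rightarrow>\<^sub>M N"
    by (rule measurable_component_singleton) simp
  have "distr (distr M (\<Pi>\<^sub>M s\<in>{0::int}. N) (\<lambda>x. \<lambda>s\<in>{0}. X (s + u) x)) N (\<lambda>f. f 0) = distr M N (X u)" for u
    by (subst distr_distr) (auto simp: comp_def)
  from this[of t] this[of 0] show ?thesis using eq by simp
qed

lemma (in prob_space) exists_tail_bound:
  fixes f :: "'a \<Rightarrow> real"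
  assumes [measurable]: "f \<in> borel_measurable M" and a: "0 < a"
  obtains B where "0 \<le> B" "prob {x \<in> space M. B < \<bar>f x\<bar>} < a"
proof -
  have "(\<lambda>n. prob {x \<in> space M. real n < \<bar>f x\<bar>}) \<longlonglongrightarrow> prob (\<Inter>n. {x \<in> space M. real n < \<bar>f x\<bar>})"
    by (intro finite_Lim_measure_decseq) (auto simp: decseq_def)
  moreover have "(\<Inter>n. {x \<in> space M. real n < \<bar>f x\<bar>}) = {}"
  proof (rule equals0I)
    fix x assume "x \<in> (\<Inter>n. {x \<in> space M. real n < \<bar>f x\<bar>})"
    then have "real n < \<bar>f x\<bar>" for n by simp
    moreover obtain n where "\<bar>f x\<bar> \<le> real n" using real_arch_simple by blast
    ultimately show False by (metis not_less)
  qed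
  ultimately have "(\<lambda>n. prob {x \<in> space M. real n < \<bar>f x\<bar>}) \<longlonglongrightarrow> 0" by simp
  then have "\<forall>\<^sub>F n in sequentially. prob {x \<in> space M. real n < \<bar>f x\<bar>} < a"
    using a by (rule order_tendstoD)
  then obtain n where "prob {x \<in> space M. real n < \<bar>f x\<bar>} < a"
    by (auto simp: eventually_sequentially)
  then show thesis
    using that[of "real n"] by simp
qed

text \<open>Boundedness in probability, uniformly in the index: the only size control at hand for an
  arbitrary stationary solution.\<close>

definition (in prob_space) tight_family :: "('i \<Rightarrow> 'a \<Rightarrow> real) \<Rightarrow> bool" where
  "tight_family f \<longleftrightarrow> (\<forall>a>0. \<exists>B\<ge>0. \<forall>t. prob {x \<in> space M. B < \<bar>f t x\<bar>} < a)"

lemma (in prob_space) tight_family_diff: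
  assumes f: "tight_family f" and g: "tight_family g"
    and [measurable]: "\<And>t. f t \<in> borel_measurable M" "\<And>t. g t \<in> borel_measurable M"
  shows "tight_family (\<lambda>t x. f t x - g t x)"
  unfolding tight_family_def
proof (intro allI impI)
  fix a :: real assume a: "0 < a"
  obtain B1 where B1: "0 \<le> B1" "\<And>t. prob {x \<in> space M. B1 < \<bar>f t x\<bar>} < a / 2"
    using f a unfolding tight_family_def by (meson half_gt_zero)
  obtain B2 where B2: "0 \<le> B2" "\<And>t. prob {x \<in> space M. B2 < \<bar>g t x\<bar>} < a / 2"
    using g a unfolding tight_family_def by (meson half_gt_zero)
  have "prob {x \<in> space M. B1 + B2 < \<bar>f t x - g t x\<bar>} < a" for t
  proof -
    have "prob {x \<in> space M. B1 + B2 < \<bar>f t x - g t x\<bar>}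
        \<le> prob ({x \<in> space M. B1 < \<bar>f t x\<bar>} \<union> {x \<in> space M. B2 < \<bar>g t x\<bar>})"
      by (intro finite_measure_mono) auto
    also have "\<dots> \<le> prob {x \<in> space M. B1 < \<bar>f t x\<bar>} + prob {x \<in> space M. B2 < \<bar>g t x\<bar>}"
      by (intro measure_Un_le) auto
    finally show ?thesis using B1(2)[of t] B2(2)[of t] by simp
  qed
  then show "\<exists>B\<ge>0. \<forall>t. prob {x \<in> space M. B < \<bar>f t x - g t x\<bar>} < a"
    using B1(1) B2(1) by (intro exI[of _ "B1 + B2"]) auto
qed

text \<open>All variables share one law, so one tail bound serves every index. The time change
  \<open>s\<close> accommodates the lags inside the state vector.\<close>

lemma (in prob_space) stationary_tight_family:
  fixes X :: "int \<Rightarrow> 'a \<Rightarrow> 'c" and \<phi> :: "'c \<Rightarrow> real"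
  assumes X: "strictly_stationary M N X" and \<phi> [measurable]: "\<phi> \<in> borel_measurable N"
  shows "tight_family (\<lambda>t x. \<phi> (X (s t) x))"
  unfolding tight_family_def
proof (intro allI impI)
  fix a :: real assume "0 < a"
  have [measurable]: "X t \<in> M \<rightarrow>\<^sub>M N" for t
    using X by (simp add: strictly_stationary_def)
  obtain B where B: "0 \<le> B" "prob {x \<in> space M. B < \<bar>\<phi> (X 0 x)\<bar>} < a"
    using exists_tail_bound[of "\<lambda>x. \<phi> (X 0 x)" a] \<open>0 < a\<close> by auto
  have "prob {x \<in> space M. B < \<bar>\<phi> (X t x)\<bar>} = measure (distr M N (X t)) {y \<in> space N. B < \<bar>\<phi> y\<bar>}" for t
    by (subst measure_distr) (auto intro!: arg_cong[where f=prob] measurable_space[of "X t" M N])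
  then have eq: "prob {x \<in> space M. B < \<bar>\<phi> (X t x)\<bar>} = prob {x \<in> space M. B < \<bar>\<phi> (X 0 x)\<bar>}" for t
    using strictly_stationary_distr[OF X, of t] by simp
  show "\<exists>B\<ge>0. \<forall>t. prob {x \<in> space M. B < \<bar>\<phi> (X (s t) x)\<bar>} < a"
  proof (intro exI[of _ B] conjI allI)
    show "prob {x \<in> space M. B < \<bar>\<phi> (X (s t) x)\<bar>} < a" for t
      unfolding eq[of "s t"] by (rule B(2))
  qed (rule B(1))
qed

section \<open>The stationary solution\<close>

lemma (in iid_process) marginal_prob:
  assumes "Measurable.pred N Q"
  shows "prob {x \<in> space M. Q (X t x)} = prob {x \<in> space M. Q (X s x)}"
proof -
  have "prob {x \<in> space M. Q (X t x)} = measure (distr M N (X t)) {y \<in> space N. Q y}" for t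
    using assms by (subst measure_distr) (auto intro!: arg_cong[where f=prob] measurable_space[OF X_measurable])
  then show ?thesis using distr_eq[of s t] by simp
qed

lemma elog_plus_elog_nonzero:
  assumes "e \<noteq> 0"
  shows "e2ennreal (elog_plus \<bar>elog (ereal (e\<^sup>2))\<bar>) = ennreal (max 0 (ln \<bar>ln (e\<^sup>2)\<bar>))"
proof -
  have "\<bar>elog (ereal (e\<^sup>2))\<bar> = ereal \<bar>ln (e\<^sup>2)\<bar>"
    using assms by (simp add: elog_ereal_pos)
  moreover have "elog_plus (ereal \<bar>y\<bar>) = ereal (max 0 (ln \<bar>y\<bar>))" for y
    \<comment> \<open>At \<open>y = 0\<close> the extended logarithm is minus infinity and the real
      one is 0; the positive part is 0 in both cases.\<close>
    by (cases "y = 0") (auto simp: elog_plus_def elog_ereal_pos elog_ereal_nonpos max_def zero_ereal_def)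
  ultimately show ?thesis by (simp only: e2ennreal_ereal)
qed

lemma elog_plus_elog_zero: "e2ennreal (elog_plus \<bar>elog (ereal (0\<^sup>2))\<bar>) = \<infinity>"
  by (simp add: elog_plus_def elog_def)

locale log_garch = iid_process M borel \<eta> for M :: "'a measure" and \<eta> :: "int \<Rightarrow> 'a \<Rightarrow> real" +
  fixes p q :: nat and \<omega> :: real and \<alpha>p \<alpha>m \<beta> :: "nat \<Rightarrow> real" and nrm :: "real mat \<Rightarrow> real"
  assumes log_moment: "(\<integral>\<^sup>+ x. e2ennreal (elog_plus \<bar>elog (ereal ((\<eta> 0 x)\<^sup>2))\<bar>) \<partial>M) < \<infinity>"
    and norm: "submultiplicative_norm (2 * q + p) nrm"
    and lyapunov: "top_lyapunov M (2 * q + p) nrm (\<lambda>t x. garch_matrix p q \<alpha>p \<alpha>m \<beta> (\<eta> t x)) < 0"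
begin

abbreviation "dm \<equiv> 2 * q + p"
abbreviation "gm \<equiv> garch_matrix p q \<alpha>p \<alpha>m \<beta>"
abbreviation "cr \<equiv> coeff_row q \<alpha>p \<alpha>m \<beta>"
abbreviation "iv \<equiv> input_vec q \<omega>"

sublocale random_matrix_product M borel \<eta> dm gm nrm
proof
  show "gm e \<in> carrier_mat dm dm" for e by (simp add: garch_matrix_def)
qed (use garch_matrix_measurable garch_matrix_finite_range norm in auto)

text \<open>At a zero innovation the integrand of the log moment is infinite, so finiteness of the
  moment forbids an atom at 0; equal marginals carry this to every time.\<close>

lemma innovations_nonzero: "AE x in M. \<forall>t. \<eta> t x \<noteq> 0"
proof -
  let ?f = "\<lambda>x. e2ennreal (elog_plus \<bar>elog (ereal ((\<eta> 0 x)\<^sup>2))\<bar>)"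
  let ?Z = "{x \<in> space M. \<eta> 0 x = 0}"
  have "emeasure M ?Z = 0"
  proof (rule ccontr)
    assume "emeasure M ?Z \<noteq> 0"
    then have "\<infinity> = (\<integral>\<^sup>+ x. \<infinity> * indicator ?Z x \<partial>M)"
      by (subst nn_integral_cmult_indicator) (auto simp: ennreal_top_mult)
    also have "\<dots> \<le> (\<integral>\<^sup>+ x. ?f x \<partial>M)"
    proof (rule nn_integral_mono)
      show "\<infinity> * indicator ?Z x \<le> ?f x" for x
        using elog_plus_elog_zero by (cases "x \<in> ?Z") auto
    qed
    finally show False using log_moment by simp
  qed
  then have "prob ?Z = 0" by (simp add: emeasure_eq_measure)
  then have "prob {x \<in> space M. \<eta> t x = 0} = 0" for t
    using marginal_prob[of "\<lambda>y. y = 0" t 0] by simp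
  then have "AE x in M. \<eta> t x \<noteq> 0" for t
    by (subst AE_iff_measurable[OF _ refl]) (auto simp: emeasure_eq_measure)
  then show ?thesis by (simp add: AE_all_countable)
qed

lemma log_log_integrable: "integrable M (\<lambda>x. max 0 (ln \<bar>ln ((\<eta> 0 x)\<^sup>2)\<bar>))"
proof (rule integrableI_bounded)
  have "(\<integral>\<^sup>+ x. ennreal (norm (max 0 (ln \<bar>ln ((\<eta> 0 x)\<^sup>2)\<bar>))) \<partial>M)
      \<le> (\<integral>\<^sup>+ x. e2ennreal (elog_plus \<bar>elog (ereal ((\<eta> 0 x)\<^sup>2))\<bar>) \<partial>M)"
  proof (rule nn_integral_mono)
    show "ennreal (norm (max 0 (ln \<bar>ln ((\<eta> 0 x)\<^sup>2)\<bar>)))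
        \<le> e2ennreal (elog_plus \<bar>elog (ereal ((\<eta> 0 x)\<^sup>2))\<bar>)" for x
    proof (cases "\<eta> 0 x = 0")
      case False
      show ?thesis unfolding elog_plus_elog_nonzero[OF False] by simp
    next
      case True
      show ?thesis unfolding True elog_plus_elog_zero by simp
    qed
  qed
  then show "(\<integral>\<^sup>+ x. ennreal (norm (max 0 (ln \<bar>ln ((\<eta> 0 x)\<^sup>2)\<bar>))) \<partial>M) < \<infinity>"
    using log_moment by (rule le_less_trans)
qed measurable

text \<open>The event says that the logarithm of \<open>\<bar>ln (\<eta>\<^sup>2)\<bar>\<close>
  exceeds \<open>c * real n\<close>. Its probabilities are summable because the positive part of
  that logarithm is integrable. As \<open>c\<close> is arbitrary, any geometric decay wins.\<close>

lemma log_innovations_subexponential: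
  assumes c: "0 < c"
  shows "AE x in M. \<forall>\<^sub>F n in sequentially. \<bar>ln ((\<eta> (t - int n) x)\<^sup>2)\<bar> \<le> exp (c * real n)"
proof -
  have "AE x in M. \<forall>\<^sub>F n in sequentially. \<not> exp (c * real n) < \<bar>ln ((\<eta> (t - int n) x)\<^sup>2)\<bar>"
  proof (rule AE_eventually_not)
    show "Measurable.pred M (\<lambda>x. exp (c * real n) < \<bar>ln ((\<eta> (t - int n) x)\<^sup>2)\<bar>)" for n by measurable
    show "summable (\<lambda>n. prob {x \<in> space M. exp (c * real n) < \<bar>ln ((\<eta> (t - int n) x)\<^sup>2)\<bar>})"
    proof (rule summable_comparison_test')
      show "summable (\<lambda>n. prob {x \<in> space M. c * real n < max 0 (ln \<bar>ln ((\<eta> 0 x)\<^sup>2)\<bar>)})"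
        by (rule tail_probabilities_summable[OF log_log_integrable _ c]) simp
      fix n
      have "prob {x \<in> space M. exp (c * real n) < \<bar>ln ((\<eta> (t - int n) x)\<^sup>2)\<bar>}
          = prob {x \<in> space M. exp (c * real n) < \<bar>ln ((\<eta> 0 x)\<^sup>2)\<bar>}"
        by (rule marginal_prob) measurable
      also have "\<dots> \<le> prob {x \<in> space M. c * real n < max 0 (ln \<bar>ln ((\<eta> 0 x)\<^sup>2)\<bar>)}"
      proof (rule finite_measure_mono)
        have "c * real n < ln y" if "exp (c * real n) < y" for y
          using that by (smt (verit) exp_gt_zero ln_exp ln_less_cancel_iff)
        then show "{x \<in> space M. exp (c * real n) < \<bar>ln ((\<eta> 0 x)\<^sup>2)\<bar>}
            \<subseteq> {x \<in> space M. c * real n < max 0 (ln \<bar>ln ((\<eta> 0 x)\<^sup>2)\<bar>)}"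
          by (auto simp: less_max_iff_disj)
      qed measurable
      finally show "norm (prob {x \<in> space M. exp (c * real n) < \<bar>ln ((\<eta> (t - int n) x)\<^sup>2)\<bar>})
          \<le> prob {x \<in> space M. c * real n < max 0 (ln \<bar>ln ((\<eta> 0 x)\<^sup>2)\<bar>)}"
        by simp
    qed
  qed
  then show ?thesis by (simp add: not_less)
qed

section \<open>The series solution\<close>

definition summand :: "nat \<Rightarrow> int \<Rightarrow> (int \<Rightarrow> real) \<Rightarrow> nat \<Rightarrow> real" where
  "summand n t h i = (\<Sum>j<dm. bprod n t h $$ (i, j) * iv (h (t - int n)) j)"

text \<open>On a path where the series diverges, \<open>suminf\<close> still yields a value
  determined by the terms alone. Shift equivariance therefore holds on every path, as the factor
  lemmas require, and not just almost surely.\<close>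

definition state :: "int \<Rightarrow> (int \<Rightarrow> real) \<Rightarrow> nat \<Rightarrow> real" where
  "state t h i = (\<Sum>n. summand n t h i)"

definition log_var :: "int \<Rightarrow> (int \<Rightarrow> real) \<Rightarrow> real" where
  "log_var t h = \<omega> + (\<Sum>j<dm. cr j * state (t - 1) h j)"

definition vol :: "int \<Rightarrow> (int \<Rightarrow> real) \<Rightarrow> real" where
  "vol t h = exp (log_var t h / 2)"

definition obs :: "int \<Rightarrow> (int \<Rightarrow> real) \<Rightarrow> real" where
  "obs t h = vol t h * h t"

lemma summands_summable:
  "AE x in M. \<forall>t. \<forall>i<dm. summable (\<lambda>n. summand n t (path x) i)"
proof -
  obtain K where K: "0 \<le> K"
    "\<And>A i j. A \<in> carrier_mat dm dm \<Longrightarrow> i < dm \<Longrightarrow> j < dm \<Longrightarrow> \<bar>A $$ (i, j)\<bar> \<le> K * nrm A"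
    using submultiplicative_norm_entry_bound[OF norm] by blast
  obtain \<rho> where \<rho>: "0 < \<rho>" "\<rho> < 1"
    "\<And>t. summable (\<lambda>n. prob {x \<in> space M. \<rho> ^ n < nrm (bprod n t (path x))})"
    using norm_exponential_decay[OF lyapunov] by blast
  \<comment> \<open>Half of the decay: the products contribute \<open>\<rho> ^ n\<close>, the inputs
    are allowed to grow like \<open>s\<close> to the power \<open>- n\<close>, and terms of order
    \<open>s ^ n\<close> remain.\<close>
  define s where "s = sqrt \<rho>"
  have s: "0 < s" "s < 1" "s * s = \<rho>" using \<rho> by (auto simp: s_def)
  have "\<rho> \<le> s" using s mult_left_mono[of s 1 s] by simp
  have "AE x in M. \<forall>i<dm. summable (\<lambda>n. summand n t (path x) i)" for t
  proof -
    have 1: "AE x in M. \<forall>\<^sub>F n in sequentially. \<not> \<rho> ^ n < nrm (bprod n t (path x))"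
      using \<rho>(3) by (intro AE_eventually_not) measurable
    have 2: "AE x in M. \<forall>\<^sub>F n in sequentially. \<bar>ln ((\<eta> (t - int n) x)\<^sup>2)\<bar> \<le> exp (- ln s * real n)"
      using s by (intro log_innovations_subexponential) simp
    show ?thesis
      using 1 2
    proof eventually_elim
      case (elim x)
      show ?case
      proof (intro allI impI)
        fix i assume i: "i < dm"
        have "\<forall>\<^sub>F n in sequentially. norm (summand n t (path x) i) \<le> real dm * (K * (\<bar>\<omega>\<bar> + 1)) * s ^ n"
          using elim
        proof eventually_elim
          case (elim n)
          have sn: "exp (- ln s * real n) * s ^ n = 1"
            using s by (simp add: exp_minus exp_of_nat2_mult)
          have "\<bar>bprod n t (path x) $$ (i, j) * iv (path x (t - int n)) j\<bar> \<le> K * (\<bar>\<omega>\<bar> + 1) * s ^ n"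
            if j: "j < dm" for j
          proof -
            have "\<bar>bprod n t (path x) $$ (i, j)\<bar> \<le> K * nrm (bprod n t (path x))"
              using i j by (intro K) auto
            also have "\<dots> \<le> K * \<rho> ^ n"
              using elim(1) K(1) by (intro mult_left_mono) auto
            finally have a: "\<bar>bprod n t (path x) $$ (i, j)\<bar> \<le> K * \<rho> ^ n" .
            have b: "\<bar>iv (path x (t - int n)) j\<bar> \<le> \<bar>\<omega>\<bar> + exp (- ln s * real n)"
              using abs_input_vec_le[of q \<omega> "path x (t - int n)" j] elim(2) by (simp add: path_def)
            have "\<bar>bprod n t (path x) $$ (i, j) * iv (path x (t - int n)) j\<bar>
                \<le> (K * \<rho> ^ n) * (\<bar>\<omega>\<bar> + exp (- ln s * real n))"
              unfolding abs_mult using a b K(1) \<rho> by (intro mult_mono) auto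
            also have "\<dots> = K * (\<bar>\<omega>\<bar> * \<rho> ^ n + s ^ n * (exp (- ln s * real n) * s ^ n))"
              by (simp add: s(3)[symmetric] power_mult_distrib algebra_simps)
            also have "\<dots> \<le> K * (\<bar>\<omega>\<bar> * s ^ n + s ^ n)"
              unfolding sn using K(1) \<open>\<rho> \<le> s\<close> \<rho>(1)
              by (intro mult_left_mono add_right_mono power_mono) (auto intro!: mult_left_mono power_mono)
            finally show ?thesis by (simp add: algebra_simps)
          qed
          then have "(\<Sum>j<dm. \<bar>bprod n t (path x) $$ (i, j) * iv (path x (t - int n)) j\<bar>)
              \<le> real (card {..<dm}) * (K * (\<bar>\<omega>\<bar> + 1) * s ^ n)"
            by (intro sum_bounded_above) auto
          then have "\<bar>summand n t (path x) i\<bar> \<le> real (card {..<dm}) * (K * (\<bar>\<omega>\<bar> + 1) * s ^ n)"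
            unfolding summand_def by (rule order_trans[OF sum_abs])
          then show ?case by (simp add: mult.assoc)
        qed
        moreover have "summable (\<lambda>n. real dm * (K * (\<bar>\<omega>\<bar> + 1)) * s ^ n)"
          using s by (intro summable_mult summable_geometric) auto
        ultimately show "summable (\<lambda>n. summand n t (path x) i)"
          by (rule summable_comparison_test_ev)
      qed
    qed
  qed
  then show ?thesis by (simp add: AE_all_countable)
qed

lemma bprod_Suc_entry:
  assumes "i < dm" "j < dm"
  shows "bprod (Suc n) t h $$ (i, j) = (\<Sum>k<dm. gm (h t) $$ (i, k) * bprod n (t - 1) h $$ (k, j))"
proof -
  have "bprod (Suc n) t h $$ (i, j) = (\<Sum>k = 0..<dm. gm (h t) $$ (i, k) * bprod n (t - 1) h $$ (k, j))"
    using assms carrier_matD[OF C_carrier[of "h t"]] carrier_matD[OF bprod_carrier[of n "t - 1" h]]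
    by (simp add: scalar_prod_def)
  then show ?thesis by (simp only: atLeast0LessThan)
qed

text \<open>The term of index 0 is the current input; each later term carries the current matrix as
  its leftmost factor, which is pulled out of the series.\<close>

lemma state_recursion:
  assumes sm: "\<And>t i. i < dm \<Longrightarrow> summable (\<lambda>n. summand n t h i)" and i: "i < dm"
  shows "state t h i = (\<Sum>j<dm. gm (h t) $$ (i, j) * state (t - 1) h j) + iv (h t) i"
proof -
  have 0: "summand 0 t h i = iv (h t) i"
  proof -
    have "summand 0 t h i = (\<Sum>j<dm. if j = i then iv (h t) j else 0)"
      unfolding summand_def using i by (intro sum.cong) auto
    then show ?thesis using i by (simp add: sum.delta)
  qed
  have Suc: "summand (Suc n) t h i = (\<Sum>k<dm. gm (h t) $$ (i, k) * summand n (t - 1) h k)" for n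
  proof -
    have "t - int (Suc n) = t - 1 - int n" by simp
    then have "summand (Suc n) t h i =
        (\<Sum>j<dm. \<Sum>k<dm. gm (h t) $$ (i, k) * bprod n (t - 1) h $$ (k, j) * iv (h (t - 1 - int n)) j)"
      unfolding summand_def using i
      by (intro sum.cong) (simp_all only: bprod_Suc_entry lessThan_iff sum_distrib_right)
    also have "\<dots> = (\<Sum>k<dm. \<Sum>j<dm. gm (h t) $$ (i, k) * bprod n (t - 1) h $$ (k, j) * iv (h (t - 1 - int n)) j)"
      by (rule sum.swap)
    finally show ?thesis by (simp only: summand_def sum_distrib_left mult.assoc)
  qed
  have "state t h i = (\<Sum>n. summand (Suc n) t h i) + summand 0 t h i"
    using suminf_split_head[OF sm[OF i, of t]] by (simp add: state_def)
  also have "(\<Sum>n. summand (Suc n) t h i) = (\<Sum>k<dm. \<Sum>n. gm (h t) $$ (i, k) * summand n (t - 1) h k)"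
    unfolding Suc using sm by (intro suminf_sum summable_mult) auto
  also have "\<dots> = (\<Sum>k<dm. gm (h t) $$ (i, k) * state (t - 1) h k)"
    unfolding state_def using sm by (intro sum.cong suminf_mult) auto
  finally show ?thesis by (simp only: 0)
qed

lemma state_shift: "state (t + k) h i = state t (shift k h) i"
proof -
  have "t + k - int n = t - int n + k" for n by simp
  then show ?thesis
    by (simp only: state_def summand_def bprod_shift shift_def)
qed

lemma log_var_shift: "log_var (t + k) h = log_var t (shift k h)"
proof -
  have "t + k - 1 = t - 1 + k" by simp
  then show ?thesis by (simp only: log_var_def state_shift)
qed

lemma vol_shift: "vol (t + k) h = vol t (shift k h)"
  by (simp only: vol_def log_var_shift)

lemma obs_shift: "obs (t + k) h = obs t (shift k h)"
  by (simp only: obs_def vol_shift shift_def)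

lemma state_measurable [measurable]: "(\<lambda>h. state t h i) \<in> borel_measurable PS"
proof -
  have [measurable]: "(\<lambda>h. bprod n t h $$ (i, j)) \<in> borel_measurable PS" for n t i j
    by (rule bprod_borel_measurable)
  show ?thesis unfolding state_def summand_def by measurable
qed

lemma vol_measurable [measurable]: "vol t \<in> borel_measurable PS"
  unfolding vol_def[abs_def] log_var_def by measurable

lemma obs_measurable [measurable]: "obs t \<in> borel_measurable PS"
  unfolding obs_def[abs_def] by measurable

lemma state_cong:
  assumes "\<And>u. u \<le> t \<Longrightarrow> h u = h' u"
  shows "state t h i = state t h' i"
proof -
  have "bprod n t h = bprod n t h'" for n
    using assms by (intro bprod_cong) auto
  moreover have "h (t - int n) = h' (t - int n)" for n
    using assms by simp
  ultimately show ?thesis by (simp add: state_def summand_def)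
qed

lemma obs_cong:
  assumes "\<And>u. u \<le> t \<Longrightarrow> h u = h' u"
  shows "obs t h = obs t h'"
  using assms state_cong[of "t - 1" h h'] by (simp add: obs_def vol_def log_var_def)

text \<open>Overwriting the future of the path by 0 does not change the value, since only
  coordinates up to \<open>t\<close> enter.\<close>

lemma obs_nonanticipative: "nonanticipative M \<eta> (\<lambda>t x. obs t (path x))"
  unfolding nonanticipative_def
proof
  fix t :: int
  let ?ext = "\<lambda>h u. if u \<in> {..t} then h u else (0::real)"
  have meas: "(\<lambda>h. obs t (?ext h)) \<in> borel_measurable (\<Pi>\<^sub>M u\<in>{..t}. borel)"
    by (rule measurable_compose[OF measurable_extend obs_measurable]) simp
  have eq: "obs t (path x) = obs t (?ext (\<lambda>u\<in>{..t}. \<eta> u x))" for x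
    by (rule obs_cong) (simp add: path_def)
  show "\<exists>g\<in>borel_measurable (\<Pi>\<^sub>M u\<in>{..t}. borel).
      \<forall>x\<in>space M. obs t (path x) = g (\<lambda>u\<in>{..t}. \<eta> u x)"
    using meas by (rule bexI[rotated]) (rule ballI, rule eq)
qed

lemma solution_equations:
  "log_garch_equations M \<eta> p q \<omega> \<alpha>p \<alpha>m \<beta> (\<lambda>t x. obs t (path x)) (\<lambda>t x. vol t (path x))"
  unfolding log_garch_equations_iff
  using summands_summable innovations_nonzero
proof eventually_elim
  case (elim x)
  let ?h = "path x"
  have ln_vol: "ln ((vol t ?h)\<^sup>2) = \<omega> + (\<Sum>j<dm. cr j * state (t - 1) ?h j)" for t
    by (simp add: vol_def log_var_def ln_realpow)
  have rec: "state t ?h i = (\<Sum>j<dm. gm (?h t) $$ (i, j) * state (t - 1) ?h j) + iv (?h t) i" if "i < dm" for t i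
    using elim(1) that by (intro state_recursion) auto
  \<comment> \<open>The model equations speak about the state vector of the constructed process
    itself, so it has to be identified with the series.\<close>
  have sv: "state_vec q (\<lambda>t. obs t ?h) (\<lambda>t. vol t ?h) t i = state t ?h i" if "i < dm" for t i
  proof (rule state_vec_eqI[where z="\<lambda>t. state t ?h" and e="?h"])
    show "?h t \<noteq> 0" for t using elim(2) by (simp add: path_def)
  qed (use rec ln_vol that in \<open>simp_all add: vol_def obs_def\<close>)
  show ?case
    using sv ln_vol by (auto simp: vol_def obs_def path_def)
qed

lemma stationary_solution_obs_vol:
  "stationary_solution M \<eta> p q \<omega> \<alpha>p \<alpha>m \<beta> (\<lambda>t x. obs t (path x)) (\<lambda>t x. vol t (path x))"
  unfolding stationary_solution_def
  using factor_strictly_stationary[of "\<lambda>t h. (obs t h, vol t h)" borel] solution_equations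
  by (simp add: obs_shift vol_shift)

lemma ergodic_obs_vol: "ergodic_process M borel (\<lambda>t x. (obs t (path x), vol t (path x)))"
  by (rule factor_ergodic[of "\<lambda>t h. (obs t h, vol t h)" borel]) (simp_all add: obs_shift vol_shift)

section \<open>Uniqueness\<close>

lemma linear_recursion_unfold:
  assumes rec: "\<And>t i. i < dm \<Longrightarrow> \<Delta> t i = (\<Sum>j<dm. gm (h t) $$ (i, j) * \<Delta> (t - 1) j)" and i: "i < dm"
  shows "\<Delta> t i = (\<Sum>j<dm. bprod n t h $$ (i, j) * \<Delta> (t - int n) j)"
  using i
proof (induction n arbitrary: t i)
  case 0
  have "(\<Sum>j<dm. bprod 0 t h $$ (i, j) * \<Delta> (t - int 0) j) = (\<Sum>j<dm. if j = i then \<Delta> t j else 0)"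
    using 0 by (intro sum.cong) auto
  then show ?case using 0 by (simp add: sum.delta)
next
  case (Suc n)
  have eq: "t - 1 - int n = t - int (Suc n)" by simp
  have "\<Delta> t i = (\<Sum>k<dm. gm (h t) $$ (i, k) * (\<Sum>j<dm. bprod n (t - 1) h $$ (k, j) * \<Delta> (t - 1 - int n) j))"
    unfolding rec[OF Suc.prems, of t] using Suc.IH[of _ "t - 1"] by (intro sum.cong) auto
  also have "\<dots> = (\<Sum>k<dm. \<Sum>j<dm. gm (h t) $$ (i, k) * bprod n (t - 1) h $$ (k, j) * \<Delta> (t - int (Suc n)) j)"
    unfolding eq by (simp only: sum_distrib_left mult.assoc)
  also have "\<dots> = (\<Sum>j<dm. \<Sum>k<dm. gm (h t) $$ (i, k) * bprod n (t - 1) h $$ (k, j) * \<Delta> (t - int (Suc n)) j)"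
    by (rule sum.swap)
  also have "\<dots> = (\<Sum>j<dm. bprod (Suc n) t h $$ (i, j) * \<Delta> (t - int (Suc n)) j)"
    using Suc.prems by (intro sum.cong) (simp_all only: bprod_Suc_entry lessThan_iff sum_distrib_right)
  finally show ?case .
qed

text \<open>A tight solution of the homogeneous recursion is pushed to 0 by the exponentially small
  products of the matrices.\<close>

lemma tight_linear_recursion_zero:
  fixes \<Delta> :: "int \<Rightarrow> nat \<Rightarrow> 'a \<Rightarrow> real"
  assumes [measurable]: "\<And>t i. \<Delta> t i \<in> borel_measurable M"
    and rec: "AE x in M. \<forall>t. \<forall>i<dm. \<Delta> t i x = (\<Sum>j<dm. gm (\<eta> t x) $$ (i, j) * \<Delta> (t - 1) j x)"
    and tight: "\<And>i. i < dm \<Longrightarrow> tight_family (\<lambda>t. \<Delta> t i)"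
    and i: "i < dm"
  shows "AE x in M. \<Delta> t i x = 0"
proof -
  obtain K where K: "0 \<le> K"
    "\<And>A i j. A \<in> carrier_mat dm dm \<Longrightarrow> i < dm \<Longrightarrow> j < dm \<Longrightarrow> \<bar>A $$ (i, j)\<bar> \<le> K * nrm A"
    using submultiplicative_norm_entry_bound[OF norm] by blast
  obtain \<rho> where \<rho>: "0 < \<rho>" "\<rho> < 1"
    "\<And>t. summable (\<lambda>n. prob {x \<in> space M. \<rho> ^ n < nrm (bprod n t (path x))})"
    using norm_exponential_decay[OF lyapunov] by blast
  have small: "prob {x \<in> space M. a < \<bar>\<Delta> t i x\<bar>} \<le> e" if a: "0 < a" and e: "0 < e" for a e :: real
  proof -
    define D where "D = real (card {..<dm})"
    have "0 < D" using i by (simp add: D_def)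
    \<comment> \<open>Half of \<open>e\<close> is shared by the coordinates for their tails, the
      other half goes to the event that the matrix product is large.\<close>
    define e' where "e' = e / (2 * D)"
    have e': "0 < e'" using e \<open>0 < D\<close> by (simp add: e'_def)
    have "\<exists>b. j < dm \<longrightarrow> 0 \<le> b \<and> (\<forall>t. prob {x \<in> space M. b < \<bar>\<Delta> t j x\<bar>} < e')" for j
      using tight[of j] e' by (auto simp: tight_family_def)
    then have "\<exists>B. \<forall>j. j < dm \<longrightarrow> 0 \<le> B j \<and> (\<forall>t. prob {x \<in> space M. B j < \<bar>\<Delta> t j x\<bar>} < e')"
      by (intro choice) blast
    then obtain B where B: "\<And>j. j < dm \<Longrightarrow> 0 \<le> B j"
      "\<And>j t. j < dm \<Longrightarrow> prob {x \<in> space M. B j < \<bar>\<Delta> t j x\<bar>} < e'" by blast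
    \<comment> \<open>The bounds \<open>B\<close> are fixed before \<open>n\<close> because
      tightness is uniform in time: they hold at \<open>t - int n\<close> however far back that
      is.\<close>
    have "(\<lambda>n. K * (\<Sum>j<dm. B j) * \<rho> ^ n) \<longlonglongrightarrow> K * (\<Sum>j<dm. B j) * 0"
      using \<rho> by (intro tendsto_intros LIMSEQ_power_zero) auto
    then have "\<forall>\<^sub>F n in sequentially. K * (\<Sum>j<dm. B j) * \<rho> ^ n < a"
      using a by (intro order_tendstoD) auto
    moreover have "\<forall>\<^sub>F n in sequentially. prob {x \<in> space M. \<rho> ^ n < nrm (bprod n t (path x))} < e / 2"
      using summable_LIMSEQ_zero[OF \<rho>(3)] e by (intro order_tendstoD) auto
    ultimately have "\<forall>\<^sub>F n in sequentially. K * (\<Sum>j<dm. B j) * \<rho> ^ n < a \<and>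
        prob {x \<in> space M. \<rho> ^ n < nrm (bprod n t (path x))} < e / 2"
      by (rule eventually_conj)
    then obtain n where n: "K * (\<Sum>j<dm. B j) * \<rho> ^ n < a"
      "prob {x \<in> space M. \<rho> ^ n < nrm (bprod n t (path x))} < e / 2"
      by (auto simp: eventually_sequentially)
    let ?U = "{x \<in> space M. \<rho> ^ n < nrm (bprod n t (path x))}"
    let ?V = "\<lambda>j. {x \<in> space M. B j < \<bar>\<Delta> (t - int n) j x\<bar>}"
    have "AE x in M. x \<in> {x \<in> space M. a < \<bar>\<Delta> t i x\<bar>} \<longrightarrow> x \<in> ?U \<union> (\<Union>j<dm. ?V j)"
      using rec AE_space
    proof eventually_elim
      case (elim x)
      show ?case
      proof (intro impI, rule ccontr)
        assume x: "x \<in> {x \<in> space M. a < \<bar>\<Delta> t i x\<bar>}" and "x \<notin> ?U \<union> (\<Union>j<dm. ?V j)"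
        then have U: "nrm (bprod n t (path x)) \<le> \<rho> ^ n"
          and V: "\<And>j. j < dm \<Longrightarrow> \<bar>\<Delta> (t - int n) j x\<bar> \<le> B j"
          using elim(2) by (auto simp: not_less)
        have "\<Delta> t i x = (\<Sum>j<dm. bprod n t (path x) $$ (i, j) * \<Delta> (t - int n) j x)"
          using elim(1) i by (intro linear_recursion_unfold[where \<Delta>="\<lambda>t i. \<Delta> t i x"]) (auto simp: path_def)
        then have "\<bar>\<Delta> t i x\<bar> \<le> (\<Sum>j<dm. \<bar>bprod n t (path x) $$ (i, j) * \<Delta> (t - int n) j x\<bar>)"
          by (simp only: sum_abs)
        also have "\<dots> \<le> (\<Sum>j<dm. K * \<rho> ^ n * B j)"
        proof (rule sum_mono)
          fix j assume "j \<in> {..<dm}"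
          then have j: "j < dm" by simp
          have "\<bar>bprod n t (path x) $$ (i, j)\<bar> \<le> K * nrm (bprod n t (path x))"
            using i j by (intro K) auto
          also have "\<dots> \<le> K * \<rho> ^ n" using U K(1) by (rule mult_left_mono)
          finally show "\<bar>bprod n t (path x) $$ (i, j) * \<Delta> (t - int n) j x\<bar> \<le> K * \<rho> ^ n * B j"
            unfolding abs_mult using V[OF j] K(1) \<rho> by (intro mult_mono) auto
        qed
        also have "\<dots> = K * (\<Sum>j<dm. B j) * \<rho> ^ n"
          by (simp add: sum_distrib_left sum_distrib_right algebra_simps)
        also have "\<dots> < a" by (rule n)
        finally show False using x by simp
      qed
    qed
    then have "prob {x \<in> space M. a < \<bar>\<Delta> t i x\<bar>} \<le> prob (?U \<union> (\<Union>j<dm. ?V j))"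
      by (rule finite_measure_mono_AE) measurable
    also have "\<dots> \<le> prob ?U + prob (\<Union>j<dm. ?V j)"
      by (intro measure_Un_le) measurable
    also have "prob (\<Union>j<dm. ?V j) \<le> (\<Sum>j<dm. prob (?V j))"
      by (intro measure_UNION_le) auto
    also have "\<dots> \<le> real (card {..<dm}) * e'"
      using B(2) by (intro sum_bounded_above) (auto intro: less_imp_le)
    also have "\<dots> = e / 2" unfolding D_def[symmetric] using \<open>0 < D\<close> by (simp add: e'_def)
    finally show ?thesis using n(2) by simp
  qed
  \<comment> \<open>As \<open>e\<close> was arbitrary, the probability is 0 for each threshold;
    countably many thresholds suffice.\<close>
  have "prob {x \<in> space M. 1 / real (Suc k) < \<bar>\<Delta> t i x\<bar>} = 0" for k
    using field_le_epsilon[of "prob {x \<in> space M. 1 / real (Suc k) < \<bar>\<Delta> t i x\<bar>}" 0]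
      small[of "1 / real (Suc k)"] by (simp add: measure_le_0_iff)
  then have "AE x in M. \<not> 1 / real (Suc k) < \<bar>\<Delta> t i x\<bar>" for k
    by (subst AE_iff_measurable[OF _ refl]) (auto simp: emeasure_eq_measure)
  then have "AE x in M. \<forall>k. \<not> 1 / real (Suc k) < \<bar>\<Delta> t i x\<bar>"
    by (simp only: AE_all_countable) simp
  then show ?thesis
  proof eventually_elim
    case (elim x)
    show ?case
    proof (rule ccontr)
      assume "\<Delta> t i x \<noteq> 0"
      then obtain k where "1 / real (Suc k) < \<bar>\<Delta> t i x\<bar>"
        using nat_approx_posE[of "\<bar>\<Delta> t i x\<bar>"] by auto
      then show False using elim by blast
    qed
  qed
qed

text \<open>Each entry is a fixed measurable function \<open>\<phi>\<close> of the observed pair at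
  a fixed lag \<open>k\<close>, so it inherits measurability and tightness from the stationary
  process.\<close>

lemma state_vec_of_stationary:
  assumes "strictly_stationary M borel (\<lambda>t x. (\<epsilon> t x, \<sigma> t x))"
  shows "(\<lambda>x. state_vec q (\<lambda>t. \<epsilon> t x) (\<lambda>t. \<sigma> t x) t i) \<in> borel_measurable M"
    and "tight_family (\<lambda>t x. state_vec q (\<lambda>t. \<epsilon> t x) (\<lambda>t. \<sigma> t x) t i)"
proof -
  define \<phi> :: "real \<times> real \<Rightarrow> real" where
    "\<phi> y = (if i < q then of_bool (fst y > 0) * ln ((fst y)\<^sup>2)
            else if i < 2 * q then of_bool (fst y < 0) * ln ((fst y)\<^sup>2) else ln ((snd y)\<^sup>2))" for y
  define k where "k = (if i < q then i else if i < 2 * q then i - q else i - 2 * q)"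
  have \<phi> [measurable]: "\<phi> \<in> borel_measurable borel"
    unfolding \<phi>_def[abs_def] borel_prod[symmetric] by measurable
  have eq: "state_vec q (\<lambda>t. \<epsilon> t x) (\<lambda>t. \<sigma> t x) t i = \<phi> (\<epsilon> (t - int k) x, \<sigma> (t - int k) x)" for t x
    by (auto simp: state_vec_def \<phi>_def k_def)
  have [measurable]: "(\<lambda>x. (\<epsilon> t x, \<sigma> t x)) \<in> M \<rightarrow>\<^sub>M borel" for t
    using assms by (simp add: strictly_stationary_def)
  show "(\<lambda>x. state_vec q (\<lambda>t. \<epsilon> t x) (\<lambda>t. \<sigma> t x) t i) \<in> borel_measurable M"
    unfolding eq by measurable
  show "tight_family (\<lambda>t x. state_vec q (\<lambda>t. \<epsilon> t x) (\<lambda>t. \<sigma> t x) t i)"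
    unfolding eq using stationary_tight_family[OF assms \<phi>] .
qed

lemma state_vec_recursion_AE:
  assumes "log_garch_equations M \<eta> p q \<omega> \<alpha>p \<alpha>m \<beta> \<epsilon> \<sigma>"
  shows "AE x in M. \<forall>t. \<forall>i<dm. state_vec q (\<lambda>t. \<epsilon> t x) (\<lambda>t. \<sigma> t x) t i =
    (\<Sum>j<dm. gm (\<eta> t x) $$ (i, j) * state_vec q (\<lambda>t. \<epsilon> t x) (\<lambda>t. \<sigma> t x) (t - 1) j) + iv (\<eta> t x) i"
  using assms[unfolded log_garch_equations_iff] innovations_nonzero
  by eventually_elim (auto intro!: state_vec_recursion)

text \<open>The inputs depend only on the innovations and cancel in the difference. Equality of the
  states at time t - 1 then fixes the logarithm of the squared volatility at t through the
  coefficient row; positivity recovers the volatility, and multiplying by the innovation recovers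
  the observation.\<close>

lemma stationary_solution_unique:
  assumes sol: "stationary_solution M \<eta> p q \<omega> \<alpha>p \<alpha>m \<beta> \<epsilon> \<sigma>" "stationary_solution M \<eta> p q \<omega> \<alpha>p \<alpha>m \<beta> \<epsilon>' \<sigma>'"
  shows "AE x in M. \<epsilon>' t x = \<epsilon> t x \<and> \<sigma>' t x = \<sigma> t x"
proof -
  note st = sol(1)[unfolded stationary_solution_def, THEN conjunct1]
    sol(2)[unfolded stationary_solution_def, THEN conjunct1]
  note eqs = sol(1)[unfolded stationary_solution_def, THEN conjunct2]
    sol(2)[unfolded stationary_solution_def, THEN conjunct2]
  let ?sv = "\<lambda>t i x. state_vec q (\<lambda>t. \<epsilon> t x) (\<lambda>t. \<sigma> t x) t i"
  let ?sv' = "\<lambda>t i x. state_vec q (\<lambda>t. \<epsilon>' t x) (\<lambda>t. \<sigma>' t x) t i"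
  note [measurable] = state_vec_of_stationary(1)[OF st(1)] state_vec_of_stationary(1)[OF st(2)]
  have "AE x in M. ?sv t i x - ?sv' t i x = 0" if "i < dm" for t i
  proof (rule tight_linear_recursion_zero[where \<Delta>="\<lambda>t i x. ?sv t i x - ?sv' t i x", OF _ _ _ that])
    show "AE x in M. \<forall>t. \<forall>i<dm. ?sv t i x - ?sv' t i x =
        (\<Sum>j<dm. gm (\<eta> t x) $$ (i, j) * (?sv (t - 1) j x - ?sv' (t - 1) j x))"
      using state_vec_recursion_AE[OF eqs(1)] state_vec_recursion_AE[OF eqs(2)]
    proof eventually_elim
      case (elim x)
      show ?case
      proof (intro allI impI)
        fix t i assume "i < dm"
        then show "?sv t i x - ?sv' t i x = (\<Sum>j<dm. gm (\<eta> t x) $$ (i, j) * (?sv (t - 1) j x - ?sv' (t - 1) j x))"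
          using elim(1)[rule_format, of i t] elim(2)[rule_format, of i t]
          by (simp only: right_diff_distrib sum_subtractf)
      qed
    qed
    show "tight_family (\<lambda>t x. ?sv t i x - ?sv' t i x)" for i
      by (intro tight_family_diff state_vec_of_stationary st)
  qed measurable
  then have "AE x in M. \<forall>i\<in>{..<dm}. ?sv (t - 1) i x - ?sv' (t - 1) i x = 0"
    by (intro AE_finite_allI) auto
  then show ?thesis
    using eqs[unfolded log_garch_equations_iff]
  proof eventually_elim
    case (elim x)
    have "(\<Sum>j<dm. cr j * ?sv (t - 1) j x) = (\<Sum>j<dm. cr j * ?sv' (t - 1) j x)"
      using elim(1) by (intro sum.cong) auto
    then have ln: "ln ((\<sigma> t x)\<^sup>2) = ln ((\<sigma>' t x)\<^sup>2)"
      using elim(2)[rule_format, of t] elim(3)[rule_format, of t] by linarith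
    have pos: "0 < \<sigma> t x" "0 < \<sigma>' t x"
      using elim(2,3) by blast+
    then have "(\<sigma> t x)\<^sup>2 = (\<sigma>' t x)\<^sup>2"
      using ln ln_inj_iff[of "(\<sigma> t x)\<^sup>2" "(\<sigma>' t x)\<^sup>2"] by simp
    then have "\<sigma> t x = \<sigma>' t x"
      using pos by (simp add: power2_eq_iff_nonneg)
    then show ?case
      using elim(2,3) by metis
  qed
qed

end

theorem theorem2p1:
  fixes M :: "'a measure"
    and \<eta> :: "int \<Rightarrow> 'a \<Rightarrow> real"
    and p q :: nat
    and \<omega> :: real
    and \<alpha>p \<alpha>m \<beta> :: "nat \<Rightarrow> real"
    and nrm :: "real mat \<Rightarrow> real"
  assumes "prob_space M"
    and "iid M borel \<eta>"
    and "integrable M (\<eta> 0)" and "(\<integral>x. \<eta> 0 x \<partial>M) = 0"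
    and "integrable M (\<lambda>x. (\<eta> 0 x)\<^sup>2)" and "(\<integral>x. (\<eta> 0 x)\<^sup>2 \<partial>M) = 1"
    and "(\<integral>\<^sup>+ x. e2ennreal (elog_plus \<bar>elog (ereal ((\<eta> 0 x)\<^sup>2))\<bar>) \<partial>M) < \<infinity>"
    and "submultiplicative_norm (2 * q + p) nrm"
    and "top_lyapunov M (2 * q + p) nrm (\<lambda>t x. garch_matrix p q \<alpha>p \<alpha>m \<beta> (\<eta> t x)) < 0"
  shows "\<exists>\<epsilon> \<sigma>.
     stationary_solution M \<eta> p q \<omega> \<alpha>p \<alpha>m \<beta> \<epsilon> \<sigma> \<and>
     nonanticipative M \<eta> \<epsilon> \<and>
     ergodic_process M borel (\<lambda>t x. (\<epsilon> t x, \<sigma> t x)) \<and>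
     (\<forall>\<epsilon>' \<sigma>'. stationary_solution M \<eta> p q \<omega> \<alpha>p \<alpha>m \<beta> \<epsilon>' \<sigma>' \<longrightarrow>
        (\<forall>t. AE x in M. \<epsilon>' t x = \<epsilon> t x \<and> \<sigma>' t x = \<sigma> t x))"
proof -
  interpret prob_space M by fact
  interpret log_garch M \<eta> p q \<omega> \<alpha>p \<alpha>m \<beta> nrm
    by unfold_locales fact+
  show ?thesis
    using stationary_solution_obs_vol obs_nonanticipative ergodic_obs_vol
      stationary_solution_unique[OF stationary_solution_obs_vol]
    by blast
qed

end
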